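(* Let $\{\mathcal{T}(t)\}_{t\ge 0}$ be the symmetric telegraph process with speed $c>0$ and rate $\lambda>0$, and let $t>0$. For every integer $m\ge 1$, $$\mathbb{E}\Bigl[ \bigl(\max_{0\le s\le t} \mathcal{T}(s)\bigr)^m \,\Big|\, V(0) = c\Bigr] = e^{-\lambda t}(ct)^m\Bigl(\frac{2}{\lambda t}\Bigr)^{\frac{m-1}{2}}\, \Gamma\Bigl(\frac{m+1}{2}\Bigr) \Bigl[I_{\frac{m-1}{2}}(\lambda t) +I_{\frac{m+1}{2}}(\lambda t) \Bigr].$$ Hence, for $m=1$, $$\mathbb{E}\Bigl[ \max_{0\le s\le t} \mathcal{T}(s) \,\Big|\, V(0) = c\Bigr] = e^{-\lambda t}\,ct\,\bigl[I_0(\lambda t)+I_1(\lambda t)\bigr].$$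
   Context: Let $c>0$, $\lambda>0$. Let $V(0)$ be a random variable with $P\{V(0)=c\}=P\{V(0)=-c\}=\tfrac12$ and let $\{N(t)\}_{t\ge0}$ be a homogeneous Poisson process with rate $\lambda$, independent of $V(0)$. The symmetric telegraph process is $\mathcal{T}(t)=\int_0^t V(0)(-1)^{N(s)}\,ds$, $t\ge 0$ (so $\mathcal{T}(0)=0$). $\Gamma$ is the Euler gamma function and $I_\nu$ is the modified Bessel function of the first kind, $I_\nu(x)=\sum_{j\ge0}\frac{(x/2)^{2j+\nu}}{j!\,\Gamma(j+\nu+1)}$. *)

theory Defs
  imports "HOL-Probability.Probability"
begin

text \<open>
  The path conditions are required on the whole sample space (not only almost surely), as is usual
  for a counting process. Since paths are nondecreasing, the truncated subtraction on \<^typ>\<open>nat\<close>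
  gives the true increments. \<open>N\<close> is unconstrained at negative times.
\<close>

locale poisson_process = prob_space M
  for M :: "'a measure" and N :: "real \<Rightarrow> 'a \<Rightarrow> nat" and rate :: real +
  assumes rate_pos: "rate > 0"
    and N_measurable: "\<And>t. t \<ge> 0 \<Longrightarrow> N t \<in> measurable M (count_space UNIV)"
    and N_zero: "\<And>\<omega>. \<omega> \<in> space M \<Longrightarrow> N 0 \<omega> = 0"
    and N_mono: "\<And>s t \<omega>. \<omega> \<in> space M \<Longrightarrow> 0 \<le> s \<Longrightarrow> s \<le> t \<Longrightarrow> N s \<omega> \<le> N t \<omega>"
    and N_right_continuous:
      "\<And>t \<omega>. \<omega> \<in> space M \<Longrightarrow> 0 \<le> t \<Longrightarrow> continuous (at_right t) (\<lambda>s. real (N s \<omega>))"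
    and N_increment_distr:
      "\<And>s t. 0 \<le> s \<Longrightarrow> s < t \<Longrightarrow>
         distr M (count_space UNIV) (\<lambda>\<omega>. N t \<omega> - N s \<omega>) = measure_pmf (poisson_pmf (rate * (t - s)))"
    and N_indep_increments:
      "\<And>(n::nat) (\<tau> :: nat \<Rightarrow> real). 0 \<le> \<tau> 0 \<Longrightarrow> (\<And>i. i < n \<Longrightarrow> \<tau> i < \<tau> (Suc i)) \<Longrightarrow>
         indep_vars (\<lambda>_. count_space UNIV) (\<lambda>i \<omega>. N (\<tau> (Suc i)) \<omega> - N (\<tau> i) \<omega>) {..<n}"

text \<open>
  \<open>V0\<close> is independent of the whole process \<open>{N t | t. t \<ge> 0}\<close>, viewed as one random element of the
  product space over the index set \<^term>\<open>{0::real..}\<close>. Independence is stated for the generated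
  \<open>\<sigma>\<close>-algebras, since \<open>indep_var\<close> needs both variables to have the same value type.
\<close>

locale symmetric_telegraph = poisson_process M N rate
  for M :: "'a measure" and V0 :: "'a \<Rightarrow> real" and N :: "real \<Rightarrow> 'a \<Rightarrow> nat"
    and c :: real and rate :: real +
  assumes speed_pos: "c > 0"
    and V0_measurable: "V0 \<in> borel_measurable M"
    and V0_pos: "prob {\<omega> \<in> space M. V0 \<omega> = c} = 1 / 2"
    and V0_neg: "prob {\<omega> \<in> space M. V0 \<omega> = - c} = 1 / 2"
    and V0_indep_N:
      "indep_set (sets (vimage_algebra (space M) V0 borel))
         (sets (vimage_algebra (space M) (\<lambda>\<omega>. \<lambda>t\<in>{0..}. N t \<omega>)
           (PiM {0..} (\<lambda>_. count_space UNIV))))"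

definition telegraph :: "('a \<Rightarrow> real) \<Rightarrow> (real \<Rightarrow> 'a \<Rightarrow> nat) \<Rightarrow> real \<Rightarrow> 'a \<Rightarrow> real" where
  "telegraph V0 N t \<omega> = (LINT s:{0..t}|lborel. V0 \<omega> * (-1) ^ N s \<omega>)"

text \<open>
  The supremum is a maximum, by lemma \<open>telegraph_max_attained\<close> below.
\<close>

definition telegraph_max :: "('a \<Rightarrow> real) \<Rightarrow> (real \<Rightarrow> 'a \<Rightarrow> nat) \<Rightarrow> real \<Rightarrow> 'a \<Rightarrow> real" where
  "telegraph_max V0 N t \<omega> = (SUP s\<in>{0..t}. telegraph V0 N s \<omega>)"

text \<open>Expectation of \<open>X\<close> conditional on an event \<open>A\<close> of positive probability.\<close>

definition cond_expectation :: "'a measure \<Rightarrow> ('a \<Rightarrow> real) \<Rightarrow> 'a set \<Rightarrow> real" where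
  "cond_expectation M X A = integral\<^sup>L (uniform_measure M A) X"

text \<open>
  Only meant for \<open>x > 0\<close>: since \<open>0 powr 0 = 0\<close>, the value at \<open>x = 0\<close>, \<open>\<nu> = 0\<close> is not the
  conventional \<open>1\<close>.
\<close>

definition bessel_I :: "real \<Rightarrow> real \<Rightarrow> real" where
  "bessel_I \<nu> x = (\<Sum>j. (x / 2) powr (2 * real j + \<nu>) / (fact j * Gamma (real j + \<nu> + 1)))"

context symmetric_telegraph
begin

lemma telegraph_integrand_integrable:
  assumes w: "\<omega> \<in> space M"
  shows "set_integrable lborel {0..t} (\<lambda>s. V0 \<omega> * (-1) ^ N s \<omega>)"
proof -
  have "mono (\<lambda>s. real (N (max 0 s) \<omega>))"
    using N_mono[OF w] by (auto simp: mono_def)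
  then have "(\<lambda>s. real (N (max 0 s) \<omega>)) \<in> borel_measurable borel"
    by (rule borel_measurable_mono)
  then have "(\<lambda>s. nat \<lfloor>real (N (max 0 s) \<omega>)\<rfloor>) \<in> measurable borel (count_space UNIV)"
    by measurable
  then have m: "(\<lambda>s. N (max 0 s) \<omega>) \<in> measurable borel (count_space UNIV)"
    by simp
  have m2: "(\<lambda>s. V0 \<omega> * (-1) ^ N (max 0 s) \<omega>) \<in> borel_measurable borel"
    by (rule measurable_compose[OF m]) simp
  have "set_integrable lborel {0..t} (\<lambda>s. V0 \<omega> * (-1) ^ N (max 0 s) \<omega>)"
    unfolding set_integrable_def
    by (rule integrableI_bounded_set_indicator[where B="\<bar>V0 \<omega>\<bar>"])
       (use m2 in \<open>auto simp: abs_mult power_abs emeasure_lborel_Icc_eq\<close>)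
  then show ?thesis
    by (rule set_integrable_cong[THEN iffD1, rotated -1]) auto
qed

lemma telegraph_max_attained:
  assumes w: "\<omega> \<in> space M" and t: "0 \<le> t"
  obtains s where "s \<in> {0..t}" "telegraph_max V0 N t \<omega> = telegraph V0 N s \<omega>"
    "\<And>r. r \<in> {0..t} \<Longrightarrow> telegraph V0 N r \<omega> \<le> telegraph V0 N s \<omega>"
proof -
  let ?f = "\<lambda>s. V0 \<omega> * (-1) ^ N s \<omega>"
  have eq: "telegraph V0 N s \<omega> = integral {0..s} ?f" for s
    unfolding telegraph_def
    by (rule set_borel_integral_eq_integral(2)[OF telegraph_integrand_integrable[OF w]])
  have "continuous_on {0..t} (\<lambda>s. integral {0..s} ?f)"
    by (rule indefinite_integral_continuous_1)
       (rule set_borel_integral_eq_integral(1)[OF telegraph_integrand_integrable[OF w]])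
  then have cont: "continuous_on {0..t} (\<lambda>s. telegraph V0 N s \<omega>)"
    by (simp add: eq)
  obtain s where s: "s \<in> {0..t}" and
    mx: "\<And>r. r \<in> {0..t} \<Longrightarrow> telegraph V0 N r \<omega> \<le> telegraph V0 N s \<omega>"
    using continuous_attains_sup[OF compact_Icc _ cont] t by auto
  have "telegraph_max V0 N t \<omega> = telegraph V0 N s \<omega>"
    unfolding telegraph_max_def using s mx by (intro cSup_eq_maximum) auto
  with s mx show thesis using that by blast
qed

end

end

theory Submission
  imports Defs "HOL-Real_Asymp.Real_Asymp"
begin

text \<open>
  Cut \<open>[0, t]\<close> into \<open>K\<close> steps of length \<open>t / K\<close>. The parities of the Poisson increments are
  independent coin flips, and they drive a persistent walk whose maximum, times \<open>t / K\<close>,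
  converges to the maximum of the telegraph process.

  For the walk, a reflection principle holds: started upwards, its maximum has the law of
  \<open>S\<close> if \<open>S \<ge> 0\<close> and of \<open>- S - 1\<close> if \<open>S < 0\<close>, where \<open>S\<close> is the endpoint. So the maximum and \<open>\<bar>S\<bar>\<close>
  have the same limit law.

  The even moments of \<open>S\<close> satisfy, up to a discretisation error, a closed system of differential
  equations. With \<open>x = \<lambda>t\<close>, its solution shows that the limit of \<open>(S / K)\<^sup>2\<close> has the integer moments of a
  mixture of Beta laws with parameters \<open>1/2\<close> and \<open>\<lceil>n/2\<rceil>\<close>, where \<open>n\<close> is Poisson with mean \<open>x\<close>. By
  Weierstrass approximation the same holds for the real powers \<open>m/2\<close>, which are the absolute
  moments, also for odd \<open>m\<close>. The even and odd \<open>n\<close> give the two Bessel series.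
\<close>

section \<open>Reflection principle for the persistent walk\<close>

text \<open>Differential equations reach only even moments: as S' = v and v^2 = 1, S^(2k) leads to v
  S^(2k-1) and this to S^(2k-2), whereas \<bar>S\<bar> is not smooth at 0. Odd m is therefore
  treated through real powers of S^2. A step flips with the exact probability (1 - exp(-2 \<eta>)) /
  2 of an odd increment, not with its first-order value, so the sampled parities have precisely the
  law of the walk and only positions are approximated. On reaching a level the walk still remembers
  its velocity, so the path cannot simply be mirrored from there; the reflection is instead a pair
  of identities proved by first-step induction. Origin of the Beta laws: given n \<ge> 1 switches,
  their times are uniform, the fraction U of time spent moving upwards is a Beta variable, and (2U -
  1)^2 has Beta parameters 1/2 and ceil(n/2). The proof never conditions on n; it recovers this
  mixture from generating functions.\<close>

text \<open>
  A list of flips drives a walk: \<open>True\<close> reverses the velocity before the step is made, and \<open>v\<close> is the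
  velocity before the first flip. \<open>flip_exp p K\<close> is the expectation over \<open>K\<close> independent flips of
  probability \<open>p\<close>, and \<open>walk_max\<close> includes the starting point \<open>0\<close>.
\<close>

fun flip_exp :: "real \<Rightarrow> nat \<Rightarrow> (bool list \<Rightarrow> real) \<Rightarrow> real" where
  "flip_exp p 0 F = F []"
| "flip_exp p (Suc K) F =
     (1 - p) * flip_exp p K (\<lambda>bs. F (False # bs)) + p * flip_exp p K (\<lambda>bs. F (True # bs))"

fun walk :: "real \<Rightarrow> bool list \<Rightarrow> real" where
  "walk v [] = 0"
| "walk v (b # bs) = (let v' = if b then - v else v in v' + walk v' bs)"

fun walk_max :: "real \<Rightarrow> bool list \<Rightarrow> real" where
  "walk_max v [] = 0"
| "walk_max v (b # bs) = (let v' = if b then - v else v in max 0 (v' + walk_max v' bs))"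

fun walk_vel :: "real \<Rightarrow> bool list \<Rightarrow> real" where
  "walk_vel v [] = v"
| "walk_vel v (b # bs) = walk_vel (if b then - v else v) bs"

section \<open>Expectations over finitely many flips\<close>

lemma flip_exp_const [simp]: "flip_exp p K (\<lambda>_. a) = a"
  by (induction K) (auto simp: algebra_simps)

lemma flip_exp_add: "flip_exp p K (\<lambda>bs. F bs + G bs) = flip_exp p K F + flip_exp p K G"
  by (induction K arbitrary: F G) (auto simp: algebra_simps)

lemma flip_exp_cmult: "flip_exp p K (\<lambda>bs. a * F bs) = a * flip_exp p K F"
  by (induction K arbitrary: F) (auto simp: algebra_simps)

lemma flip_exp_diff: "flip_exp p K (\<lambda>bs. F bs - G bs) = flip_exp p K F - flip_exp p K G"
  using flip_exp_add[of p K F "\<lambda>bs. (- 1) * G bs"] flip_exp_cmult[of p K "- 1" G] by simp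

lemma flip_exp_sum:
  "flip_exp p K (\<lambda>bs. \<Sum>i\<in>I. F i bs) = (\<Sum>i\<in>I. flip_exp p K (F i))"
  by (induction I rule: infinite_finite_induct) (auto simp: flip_exp_add)

lemma flip_exp_cong:
  assumes "\<And>bs. length bs = K \<Longrightarrow> F bs = G bs"
  shows "flip_exp p K F = flip_exp p K G"
  using assms
proof (induction K arbitrary: F G)
  case (Suc K)
  have "flip_exp p K (\<lambda>bs. F (b # bs)) = flip_exp p K (\<lambda>bs. G (b # bs))" for b
    by (rule Suc.IH) (use Suc.prems in auto)
  then show ?case by simp
qed auto

lemma flip_exp_mono:
  assumes "0 \<le> p" "p \<le> 1" "\<And>bs. length bs = K \<Longrightarrow> F bs \<le> G bs"
  shows "flip_exp p K F \<le> flip_exp p K G"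
  using assms
proof (induction K arbitrary: F G)
  case (Suc K)
  have "flip_exp p K (\<lambda>bs. F (b # bs)) \<le> flip_exp p K (\<lambda>bs. G (b # bs))" for b
    by (rule Suc.IH) (use Suc.prems in auto)
  then show ?case using Suc.prems by (auto intro!: add_mono mult_left_mono)
qed auto

lemma flip_exp_abs_diff_le:
  assumes "0 \<le> p" "p \<le> 1" "\<And>bs. length bs = K \<Longrightarrow> \<bar>F bs - G bs\<bar> \<le> e"
  shows "\<bar>flip_exp p K F - flip_exp p K G\<bar> \<le> e"
proof -
  have "flip_exp p K (\<lambda>bs. F bs - G bs) \<le> flip_exp p K (\<lambda>_. e)"
    by (rule flip_exp_mono) (use assms abs_le_D1 in auto)
  moreover have "flip_exp p K (\<lambda>_. - e) \<le> flip_exp p K (\<lambda>bs. F bs - G bs)"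
    by (rule flip_exp_mono) (use assms in \<open>force simp: abs_le_iff\<close>)+
  ultimately show ?thesis by (simp add: flip_exp_diff abs_le_iff)
qed

text \<open>The defining recursion splits off the first flip, as first-step analysis of tails wants
  it. Moment recursions need the last flip instead, with position and velocity before it already
  known.\<close>

lemma flip_exp_snoc:
  "flip_exp p (Suc K) F =
     flip_exp p K (\<lambda>bs. (1 - p) * F (bs @ [False]) + p * F (bs @ [True]))"
proof (induction K arbitrary: F)
  case (Suc K)
  show ?case
    using Suc.IH[of "\<lambda>bs. F (False # bs)"] Suc.IH[of "\<lambda>bs. F (True # bs)"]
    by (simp only: flip_exp.simps(2)[of p "Suc K" F] append_Cons
      flip_exp.simps(2)[of p K "\<lambda>bs. (1 - p) * F (bs @ [False]) + p * F (bs @ [True])"])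
qed simp

text \<open>The form that meets the probability space: \<open>flip_path_prob\<close> supplies
  exactly these product weights.\<close>

lemma flip_exp_eq_sum:
  "flip_exp p K F =
     (\<Sum>bs | length bs = K. (\<Prod>b\<leftarrow>bs. if b then p else 1 - p) * F bs)"
proof (induction K arbitrary: F)
  case (Suc K)
  have fin: "finite {bs :: bool list. length bs = K}"
    using finite_lists_length_eq[of "UNIV :: bool set" K] by simp
  have "{bs :: bool list. length bs = Suc K} =
      (Cons False ` {bs. length bs = K}) \<union> (Cons True ` {bs. length bs = K})"
    by (auto simp: length_Suc_conv image_iff)
  then have "(\<Sum>bs | length bs = Suc K. (\<Prod>b\<leftarrow>bs. if b then p else 1 - p) * F bs) =
      (\<Sum>bs\<in>Cons False ` {bs. length bs = K}. (\<Prod>b\<leftarrow>bs. if b then p else 1 - p) * F bs) +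
      (\<Sum>bs\<in>Cons True ` {bs. length bs = K}. (\<Prod>b\<leftarrow>bs. if b then p else 1 - p) * F bs)"
    by (simp only:) (rule sum.union_disjoint, use fin in auto)
  also have "\<dots> = flip_exp p (Suc K) F"
    by (simp add: sum.reindex Suc.IH sum_distrib_left mult_ac)
  finally show ?case by simp
qed auto

section \<open>Pathwise properties of the walk and its maximum\<close>

lemma walk_minus: "walk (- v) bs = - walk v bs"
  by (induction v bs rule: walk.induct) (auto simp: Let_def)

lemma walk_max_nonneg: "walk_max v bs \<ge> 0"
  by (cases bs) (auto simp: Let_def)

lemma walk_max_scale:
  assumes "a \<ge> 0"
  shows "walk_max (a * v) bs = a * walk_max v bs"
proof (induction bs arbitrary: v)
  case (Cons b bs)
  have m: "a * max 0 y = max 0 (a * y)" for y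
    using assms max_mult_distrib_left[of a 0 y] by simp
  show ?case
    using Cons.IH[of v] Cons.IH[of "- v"] by (simp add: Let_def m distrib_left right_diff_distrib)
qed simp

lemma walk_take_le_max: "walk v (take k bs) \<le> walk_max v bs"
proof (induction bs arbitrary: v k)
  case (Cons b bs)
  show ?case
  proof (cases k)
    case (Suc k')
    with Cons.IH[of v k'] Cons.IH[of "-v" k'] show ?thesis by (auto simp: Let_def max_def)
  qed (simp add: walk_max_nonneg del: walk_max.simps)
qed auto

lemma walk_max_attained: "\<exists>k\<le>length bs. walk_max v bs = walk v (take k bs)"
proof (induction bs arbitrary: v)
  case (Cons b bs)
  define v' where "v' = (if b then - v else v)"
  from Cons.IH[of v'] obtain k where k: "k \<le> length bs" "walk_max v' bs = walk v' (take k bs)"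
    by auto
  show ?case
  proof (cases "v' + walk_max v' bs \<ge> 0")
    case True
    then show ?thesis using k
      by (intro exI[of _ "Suc k"]) (auto simp: Let_def v'_def)
  next
    case False
    then show ?thesis by (intro exI[of _ 0]) (auto simp: Let_def v'_def)
  qed
qed auto

lemma abs_walk_le: "\<bar>walk v bs\<bar> \<le> \<bar>v\<bar> * real (length bs)"
proof (induction v bs rule: walk.induct)
  case (2 v b bs)
  then show ?case
    by (cases b) (auto simp: Let_def algebra_simps intro: order_trans[OF abs_triangle_ineq])
qed auto

lemma walk_max_le: "walk_max v bs \<le> \<bar>v\<bar> * real (length bs)"
proof -
  obtain k where "k \<le> length bs" "walk_max v bs = walk v (take k bs)"
    using walk_max_attained by blast
  then have "walk_max v bs \<le> \<bar>v\<bar> * real k"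
    using abs_walk_le[of v "take k bs"] by (simp add: abs_le_iff)
  also have "\<dots> \<le> \<bar>v\<bar> * real (length bs)"
    using \<open>k \<le> length bs\<close> by (intro mult_left_mono) auto
  finally show ?thesis .
qed

lemma walk_Ints: "v \<in> \<int> \<Longrightarrow> walk v bs \<in> \<int>"
  by (induction v bs rule: walk.induct) (auto simp: Let_def split: if_splits)

lemma walk_max_Ints: "v \<in> \<int> \<Longrightarrow> walk_max v bs \<in> \<int>"
  using walk_max_attained[of bs v] walk_Ints by metis

lemma abs_walk_vel: "\<bar>walk_vel v bs\<bar> = \<bar>v\<bar>"
  by (induction v bs rule: walk_vel.induct) auto

lemma walk_vel_snoc [simp]: "walk_vel v (bs @ [b]) = (if b then - walk_vel v bs else walk_vel v bs)"
  by (induction v bs rule: walk_vel.induct) auto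

lemma walk_snoc [simp]: "walk v (bs @ [b]) = walk v bs + walk_vel v (bs @ [b])"
  by (induction v bs rule: walk.induct) (auto simp: Let_def)

section \<open>Tail functions and reflection\<close>

definition tail_end :: "real \<Rightarrow> nat \<Rightarrow> real \<Rightarrow> real \<Rightarrow> real" where
  "tail_end p K v x = flip_exp p K (\<lambda>bs. of_bool (walk v bs \<ge> x))"

definition tail_max :: "real \<Rightarrow> nat \<Rightarrow> real \<Rightarrow> real \<Rightarrow> real" where
  "tail_max p K v x = flip_exp p K (\<lambda>bs. of_bool (walk_max v bs \<ge> x))"

lemma tail_end_Suc:
  "tail_end p (Suc K) v x = (1 - p) * tail_end p K v (x - v) + p * tail_end p K (- v) (x + v)"
proof -
  have *: "(x \<le> v + b) = (x - v \<le> b)" "(x \<le> - v + b) = (x + v \<le> b)" for b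
    by auto
  show ?thesis
    unfolding tail_end_def flip_exp.simps walk.simps Let_def if_False if_True * ..
qed

text \<open>The starting point 0 does not reach a level \<open>x > 0\<close>, so the outer
  \<open>max 0\<close> drops out and the maximum obeys the same recursion as the endpoint.\<close>

lemma tail_max_Suc:
  assumes "x > 0"
  shows "tail_max p (Suc K) v x = (1 - p) * tail_max p K v (x - v) + p * tail_max p K (- v) (x + v)"
proof -
  have *: "(x \<le> max 0 (v + b)) = (x - v \<le> b)" "(x \<le> max 0 (- v + b)) = (x + v \<le> b)" for b
    using assms by auto
  show ?thesis
    unfolding tail_max_def flip_exp.simps walk_max.simps Let_def if_False if_True * ..
qed

lemma tail_max_nonpos: "x \<le> 0 \<Longrightarrow> tail_max p K v x = 1"
  using order_trans[OF _ walk_max_nonneg] by (auto simp: tail_max_def)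

text \<open>Velocity \<open>- 1\<close> gives the mirror image on the same flips, and for integers
  the negation of \<open>w \<ge> x\<close> is \<open>- w \<ge> 1 - x\<close>.\<close>

lemma tail_end_complement:
  assumes "x \<in> \<int>"
  shows "tail_end p K 1 x + tail_end p K (- 1) (1 - x) = 1"
proof -
  have "of_bool (walk 1 bs \<ge> x) + of_bool (walk (- 1) bs \<ge> 1 - x) = (1::real)" for bs
  proof -
    have "walk 1 bs \<in> \<int>" by (rule walk_Ints) auto
    with assms show ?thesis by (auto elim!: Ints_cases simp: walk_minus[of 1, simplified])
  qed
  then show ?thesis
    unfolding tail_end_def by (simp flip: flip_exp_add)
qed

text \<open>
  The second identity makes the induction close: it is what the first-step recursion forces on the
  maximum of the walk with velocity \<open>- 1\<close> once the first identity is assumed.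
\<close>

lemma walk_reflection:
  assumes p: "p > 0"
  shows "x \<ge> 0 \<Longrightarrow> x \<in> \<int> \<Longrightarrow> tail_max p K 1 x = tail_end p K 1 x + tail_end p K (- 1) (x + 1)"
    and "x \<ge> 2 \<Longrightarrow> x \<in> \<int> \<Longrightarrow>
      p * tail_max p K (- 1) x = p * (tail_end p K (- 1) x + tail_end p K 1 (x - 1))
        - (1 - p) * (tail_end p K (- 1) (x - 1) - tail_end p K (- 1) (x + 1))"
proof (induction K arbitrary: x)
  case 0
  {
    case 1
    then show ?case by (auto simp: tail_max_def tail_end_def)
  next
    case 2
    then show ?case by (auto simp: tail_max_def tail_end_def)
  }
next
  case (Suc K)
  {
    case 1
    show ?case
    proof (cases "x = 0")
      case True
      then show ?thesis using tail_end_complement[of 0 p "Suc K"]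
        by (simp add: tail_max_nonpos)
    next
      case False
      with 1 have x: "x \<ge> 1" by (auto elim!: Ints_cases)
      have u: "tail_max p K 1 (x - 1) = tail_end p K 1 (x - 1) + tail_end p K (- 1) x"
        using Suc.IH(1)[of "x - 1"] x 1 by simp
      \<comment> \<open>A reversal leads to level \<open>x + 1 \<ge> 2\<close>, just the range of
        the second identity, whose factor \<open>p\<close> is the one that the recursion
        provides.\<close>
      have v: "p * tail_max p K (- 1) (x + 1) = p * (tail_end p K (- 1) (x + 1) + tail_end p K 1 x)
        - (1 - p) * (tail_end p K (- 1) x - tail_end p K (- 1) (x + 2))"
        using Suc.IH(2)[of "x + 1"] x 1 by (simp add: add.assoc)
      have "tail_max p (Suc K) 1 x = (1 - p) * tail_max p K 1 (x - 1) + p * tail_max p K (- 1) (x + 1)"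
        using tail_max_Suc[of x p K 1] x by simp
      then show ?thesis unfolding u v tail_end_Suc by (simp add: algebra_simps)
    qed
  next
    case 2
    have u: "tail_max p K 1 (x - 1) = tail_end p K 1 (x - 1) + tail_end p K (- 1) x"
      using Suc.IH(1)[of "x - 1"] 2 by simp
    have v: "p * tail_max p K (- 1) (x + 1) = p * (tail_end p K (- 1) (x + 1) + tail_end p K 1 x)
      - (1 - p) * (tail_end p K (- 1) x - tail_end p K (- 1) (x + 2))"
      using Suc.IH(2)[of "x + 1"] 2 by (simp add: add.assoc)
    have "p * tail_max p (Suc K) (- 1) x =
        (1 - p) * (p * tail_max p K (- 1) (x + 1)) + p * p * tail_max p K 1 (x - 1)"
    proof -
      have "tail_max p (Suc K) (- 1) x =
          (1 - p) * tail_max p K (- 1) (x + 1) + p * tail_max p K 1 (x - 1)"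
        using tail_max_Suc[of x p K "-1"] 2 by simp
      then show ?thesis by algebra
    qed
    then show ?case unfolding u v tail_end_Suc by (simp add: algebra_simps)
  }
qed

text \<open>Summation by parts: on the integers from 0 to \<open>K\<close> every \<open>h\<close> is
  a combination of tail indicators, so equal tails give equal expectations of every
  \<open>h\<close>.\<close>

lemma telescoping_tail_sum:
  fixes h :: "real \<Rightarrow> real"
  assumes "r \<in> \<int>" "0 \<le> r" "r \<le> real K"
  shows "h r = h 0 + (\<Sum>i\<in>{1..K}. (h (real i) - h (real (i - 1))) * of_bool (r \<ge> real i))"
proof -
  have "r \<in> \<nat>"
    using assms by (simp add: Nats_altdef2)
  then obtain n where n: "r = real n" "n \<le> K"
    using assms(3) by (auto elim: Nats_cases)
  have "(\<Sum>i\<in>{1..K}. (h (real i) - h (real (i - 1))) * of_bool (r \<ge> real i)) =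
      (\<Sum>i\<in>{1..n}. h (real i) - h (real (i - 1)))"
    using n by (intro sum.mono_neutral_cong_right) auto
  also have "\<dots> = h (real n) - h 0"
    using sum_telescope''[of 0 n "\<lambda>i. h (real i)"] by simp
  finally show ?thesis using n by simp
qed

lemma walk_max_distribution:
  assumes p: "p > 0"
  shows "flip_exp p K (\<lambda>bs. h (walk_max 1 bs)) =
    flip_exp p K (\<lambda>bs. h (if walk 1 bs \<ge> 0 then walk 1 bs else - walk 1 bs - 1))"
proof -
  define S where "S = (\<lambda>bs. if walk 1 bs \<ge> 0 then walk 1 bs else - walk 1 bs - 1)"
  define a where "a i = h (real i) - h (real (i - 1))" for i :: nat
  have "flip_exp p K (\<lambda>bs. h (walk_max 1 bs)) =
      flip_exp p K (\<lambda>bs. h 0 + (\<Sum>i\<in>{1..K}. a i * of_bool (walk_max 1 bs \<ge> real i)))"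
    unfolding a_def
    by (intro flip_exp_cong telescoping_tail_sum)
       (use walk_max_le[of 1] in \<open>auto intro: walk_max_Ints walk_max_nonneg\<close>)
  also have "\<dots> = h 0 + (\<Sum>i\<in>{1..K}. a i * tail_max p K 1 (real i))"
    by (simp only: flip_exp_add flip_exp_sum flip_exp_cmult tail_max_def flip_exp_const)
  also have "\<dots> = h 0 + (\<Sum>i\<in>{1..K}. a i * flip_exp p K (\<lambda>bs. of_bool (S bs \<ge> real i)))"
  proof -
    have "tail_max p K 1 (real i) = flip_exp p K (\<lambda>bs. of_bool (S bs \<ge> real i))" if "i \<in> {1..K}" for i
    proof -
      \<comment> \<open>The two events on the right exclude each other because
        \<open>i \<ge> 1\<close>. Folding a negative endpoint to \<open>- walk 1 bs - 1\<close> is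
        what produces the level \<open>real i + 1\<close>.\<close>
      have "of_bool (S bs \<ge> real i) = (of_bool (walk 1 bs \<ge> real i) +
          of_bool (walk (- 1) bs \<ge> real i + 1) :: real)" for bs
        using that by (auto simp: S_def walk_minus[of 1, simplified])
      then show ?thesis
        using walk_reflection(1)[OF p, of "real i" K] by (simp add: flip_exp_add tail_end_def)
    qed
    then show ?thesis by simp
  qed
  also have "\<dots> = flip_exp p K (\<lambda>bs. h 0 + (\<Sum>i\<in>{1..K}. a i * of_bool (S bs \<ge> real i)))"
    by (simp only: flip_exp_add flip_exp_sum flip_exp_cmult flip_exp_const)
  also have "\<dots> = flip_exp p K (\<lambda>bs. h (S bs))"
    unfolding a_def
  proof (intro flip_exp_cong telescoping_tail_sum[symmetric])
    fix bs :: "bool list" assume "length bs = K"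
    moreover have "walk 1 bs \<in> \<int>" by (rule walk_Ints) auto
    ultimately show "S bs \<in> \<int>" "0 \<le> S bs" "S bs \<le> real K"
      using abs_walk_le[of 1 bs] by (auto simp: S_def elim!: Ints_cases)
  qed
  finally show ?thesis by (simp add: S_def)
qed

text \<open>Folding shifts a negative endpoint by one lattice unit, hence by 1/K after scaling, and
  y^m is Lipschitz with constant m on [0, 1].\<close>

lemma walk_max_moment_diff:
  assumes p: "0 < p" "p \<le> 1" and K: "K > 0"
  shows "\<bar>flip_exp p K (\<lambda>bs. (walk_max 1 bs / real K) ^ m)
    - flip_exp p K (\<lambda>bs. (\<bar>walk 1 bs\<bar> / real K) ^ m)\<bar> \<le> real m / real K"
proof -
  define S where "S = (\<lambda>bs. if walk 1 bs \<ge> 0 then walk 1 bs else - walk 1 bs - 1)"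
  have "flip_exp p K (\<lambda>bs. (walk_max 1 bs / real K) ^ m) =
      flip_exp p K (\<lambda>bs. (S bs / real K) ^ m)"
    using walk_max_distribution[OF p(1), of K "\<lambda>r. (r / real K) ^ m"] by (simp add: S_def)
  moreover have "\<bar>(S bs / real K) ^ m - (\<bar>walk 1 bs\<bar> / real K) ^ m\<bar> \<le> real m / real K"
    if "length bs = K" for bs
  proof -
    have "walk 1 bs \<in> \<int>" by (rule walk_Ints) auto
    then have S: "0 \<le> S bs" "S bs \<le> real K" "\<bar>S bs - \<bar>walk 1 bs\<bar>\<bar> \<le> 1"
      using abs_walk_le[of 1 bs] that by (auto simp: S_def elim!: Ints_cases)
    have "norm ((S bs / real K) ^ m - (\<bar>walk 1 bs\<bar> / real K) ^ m) \<le>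
        real m * norm (S bs / real K - \<bar>walk 1 bs\<bar> / real K)"
      by (rule norm_power_diff) (use S K that abs_walk_le[of 1 bs] in auto)
    also have "\<dots> \<le> real m * (1 / real K)"
      using S K by (intro mult_left_mono) (auto simp: diff_divide_distrib[symmetric] divide_right_mono)
    finally show ?thesis by simp
  qed
  ultimately show ?thesis
    using p flip_exp_abs_diff_le[of p K "\<lambda>bs. (S bs / real K) ^ m"] by simp
qed

text \<open>One constant for a whole interval, obtained by compactness, keeps the error of a step of
  length \<eta> at order \<open>\<eta>\<^sup>2\<close>; then x/\<eta> steps together contribute only
  order \<eta>.\<close>

lemma taylor_quadratic_bound:
  fixes f f' f'' :: "real \<Rightarrow> real"
  assumes "\<And>x. (f has_real_derivative f' x) (at x)" "\<And>x. (f' has_real_derivative f'' x) (at x)"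
    and "continuous_on UNIV f''"
  obtains C where "C \<ge> 0"
    "\<And>a b. \<bar>a\<bar> \<le> R \<Longrightarrow> \<bar>b\<bar> \<le> R \<Longrightarrow> \<bar>f b - f a - (b - a) * f' a\<bar> \<le> C * (b - a)\<^sup>2"
proof -
  have "bounded (f'' ` {-R..R})"
    by (intro compact_imp_bounded compact_continuous_image)
       (use assms(3) continuous_on_subset in auto)
  then obtain C where C: "\<And>x. x \<in> {-R..R} \<Longrightarrow> \<bar>f'' x\<bar> \<le> C"
    unfolding bounded_iff by (metis image_eqI real_norm_def)
  have bound: "\<bar>f' b - f' a\<bar> \<le> \<bar>C\<bar> * \<bar>b - a\<bar>" if "\<bar>a\<bar> \<le> R" "\<bar>b\<bar> \<le> R" for a b
    using field_differentiable_bound[of "{-R..R}" f' f'' "\<bar>C\<bar>" b a] that C assms(2)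
    by (fastforce intro: has_field_derivative_at_within)
  have "\<bar>f b - f a - (b - a) * f' a\<bar> \<le> \<bar>C\<bar> * (b - a)\<^sup>2" if ab: "\<bar>a\<bar> \<le> R" "\<bar>b\<bar> \<le> R" for a b
  proof -
    \<comment> \<open>Subtracting the linear term leaves a mean value estimate, whose derivative
      \<open>f' x - f' a\<close> is already of order \<open>\<bar>b - a\<bar>\<close> on the
      segment.\<close>
    have d: "((\<lambda>x. f x - x * f' a) has_real_derivative f' x - f' a) (at x within S)" for x S
      using assms(1)[of x] by (auto intro!: derivative_eq_intros intro: has_field_derivative_at_within)
    have "norm ((f b - b * f' a) - (f a - a * f' a)) \<le> (\<bar>C\<bar> * \<bar>b - a\<bar>) * norm (b - a)"
    proof (rule field_differentiable_bound[of "closed_segment a b" _ "\<lambda>x. f' x - f' a"])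
      fix x assume x: "x \<in> closed_segment a b"
      then have x': "\<bar>x\<bar> \<le> R" "\<bar>x - a\<bar> \<le> \<bar>b - a\<bar>"
        using ab by (auto simp: closed_segment_eq_real_ivl split: if_splits)
      show "norm (f' x - f' a) \<le> \<bar>C\<bar> * \<bar>b - a\<bar>"
        using bound[OF ab(1) x'(1)] mult_left_mono[OF x'(2), of "\<bar>C\<bar>"] by simp
    qed (use d in auto)
    also have "\<dots> = \<bar>C\<bar> * (b - a)\<^sup>2"
      by (simp add: power2_eq_square abs_mult_self_eq mult.assoc)
    also have "(f b - b * f' a) - (f a - a * f' a) = f b - f a - (b - a) * f' a"
      by algebra
    finally show ?thesis by simp
  qed
  then show thesis by (intro that[of "\<bar>C\<bar>"]) auto
qed

section \<open>Generating functions that solve the moment equations\<close>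

definition egf :: "(nat \<Rightarrow> real) \<Rightarrow> real \<Rightarrow> real" where
  "egf a x = (\<Sum>i. a i / fact i * x ^ i)"

lemma summable_egf:
  fixes a :: "nat \<Rightarrow> real"
  assumes "\<And>i. \<bar>a i\<bar> \<le> C * 2 ^ i"
  shows "summable (\<lambda>i. a i / fact i * x ^ i)"
proof (rule summable_comparison_test')
  show "summable (\<lambda>i. C * (inverse (fact i) * (2 * \<bar>x\<bar>) ^ i))"
    by (intro summable_mult summable_exp)
  show "norm (a i / fact i * x ^ i) \<le> C * (inverse (fact i) * (2 * \<bar>x\<bar>) ^ i)" if "i \<ge> 0" for i
    using mult_right_mono[OF assms[of i], of "\<bar>x\<bar> ^ i / fact i"]
    by (simp add: abs_mult power_abs power_mult_distrib divide_inverse mult_ac)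
qed

lemma egf_derivative:
  assumes "\<And>i. \<bar>a i\<bar> \<le> C * 2 ^ i"
  shows "(egf a has_real_derivative egf (\<lambda>i. a (Suc i)) x) (at x)"
proof -
  have "diffs (\<lambda>i. a i / fact i) = (\<lambda>i. a (Suc i) / fact i)"
    by (auto simp: diffs_def fun_eq_iff field_simps simp del: of_nat_Suc)
  then show ?thesis
    using termdiffs_strong_converges_everywhere[OF summable_egf[OF assms], of x]
    by (simp add: egf_def[abs_def])
qed

text \<open>Origin of the coefficients: with E S^(2k) written as (2k)! exp(-s) F_k(s), eliminating
  the velocity moments leaves F_(k+1)'' = F_(k+1) + F_k with zero initial data and F_0 = exp. On
  Taylor coefficients this is Pascal's rule along index steps of two.\<close>

definition pair_egf :: "nat \<Rightarrow> real \<Rightarrow> real" where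
  "pair_egf k = egf (\<lambda>i. real ((i div 2) choose k))"

definition pair_egf' :: "nat \<Rightarrow> real \<Rightarrow> real" where
  "pair_egf' k = egf (\<lambda>i. real ((Suc i div 2) choose k))"

lemma half_choose_le: "real ((i div 2) choose k) \<le> 2 ^ i"
proof -
  have "(i div 2) choose k \<le> 2 ^ (i div 2)" by (rule binomial_le_pow2)
  also have "\<dots> \<le> 2 ^ i" by (rule power_increasing) auto
  finally show ?thesis by (metis of_nat_le_iff of_nat_numeral of_nat_power)
qed

lemma pair_egf_derivative: "(pair_egf k has_real_derivative pair_egf' k x) (at x)"
  unfolding pair_egf_def pair_egf'_def
  by (rule egf_derivative[of _ 1]) (use half_choose_le in auto)

lemma pair_egf'_derivative:
  "(pair_egf' (Suc k) has_real_derivative pair_egf (Suc k) x + pair_egf k x) (at x)"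
proof -
  have "egf (\<lambda>i. real ((Suc (Suc i) div 2) choose Suc k)) x = pair_egf (Suc k) x + pair_egf k x"
  proof -
    have s: "summable (\<lambda>i. real ((i div 2) choose k) / fact i * x ^ i)" for k
      by (rule summable_egf[of _ 1]) (use half_choose_le in auto)
    show ?thesis
      unfolding egf_def pair_egf_def suminf_add[OF s s]
      by (simp add: add_divide_distrib distrib_right add.commute)
  qed
  moreover have "\<bar>real ((Suc i div 2) choose Suc k)\<bar> \<le> 2 * 2 ^ i" for i
    using half_choose_le[of "Suc i" "Suc k"] by simp
  ultimately show ?thesis
    unfolding pair_egf'_def using egf_derivative[of "\<lambda>i. real ((Suc i div 2) choose Suc k)" 2 x] by simp
qed

lemma pair_egf_0: "pair_egf 0 x = exp x"
  by (simp add: pair_egf_def egf_def exp_def divide_inverse scaleR_conv_of_real mult.commute)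

lemma pair_egf_at_0: "pair_egf (Suc k) 0 = 0" "pair_egf' (Suc k) 0 = 0"
  unfolding pair_egf_def pair_egf'_def egf_def powser_zero by auto

text \<open>
  Limits of \<open>E S\<^sup>2\<^sup>k\<close> and \<open>E v S\<^sup>2\<^sup>k\<^sup>+\<^sup>1\<close> for endpoint \<open>S\<close> and velocity \<open>v\<close>. Pascal's rule is what makes
  \<open>pair_egf\<close> solve the moment equations.
\<close>

definition even_moment :: "nat \<Rightarrow> real \<Rightarrow> real" where
  "even_moment k s = fact (2 * k) * exp (- s) * pair_egf k s"

definition odd_moment :: "nat \<Rightarrow> real \<Rightarrow> real" where
  "odd_moment k s = fact (2 * k + 1) * exp (- s) * (pair_egf' (Suc k) s - pair_egf (Suc k) s)"

lemma even_moment_derivative: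
  "(even_moment (Suc k) has_real_derivative real (2 * k + 2) * odd_moment k s) (at s)"
proof -
  have f: "(fact (2 * Suc k) :: real) = real (2 * k + 2) * fact (2 * k + 1)"
    using fact_Suc[of "2 * k + 1", where 'a = real] by (simp add: add.commute)
  have "((\<lambda>s. fact (2 * Suc k) * exp (- s) * pair_egf (Suc k) s) has_real_derivative
      fact (2 * Suc k) * (exp (- s) * (pair_egf' (Suc k) s - pair_egf (Suc k) s))) (at s)"
    by (rule derivative_eq_intros pair_egf_derivative refl)+ algebra
  then show ?thesis unfolding f even_moment_def[abs_def] odd_moment_def by (simp only: mult.assoc)
qed

text \<open>Limit form of the equation for v S^(2k+1): v^2 = 1 turns the derivative of the power
  into an even moment, and reversals at unit rate contribute -2 times the moment itself.\<close>

lemma odd_moment_derivative: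
  "(odd_moment k has_real_derivative real (2 * k + 1) * even_moment k s - 2 * odd_moment k s) (at s)"
proof -
  have f: "(fact (2 * k + 1) :: real) = real (2 * k + 1) * fact (2 * k)"
    using fact_Suc[of "2 * k", where 'a = real] by (simp add: add.commute)
  show ?thesis
    unfolding even_moment_def odd_moment_def[abs_def] f
    by (rule derivative_eq_intros pair_egf_derivative pair_egf'_derivative refl)+ algebra
qed

section \<open>Even moments in the continuum limit\<close>

lemma abs_mult_le:
  fixes x y a b :: real
  assumes "\<bar>x\<bar> \<le> a" "\<bar>y\<bar> \<le> b"
  shows "\<bar>x * y\<bar> \<le> a * b"
  unfolding abs_mult by (rule mult_mono) (use assms in auto)

text \<open>
  In the time unit \<open>1 / \<lambda>\<close> a step takes time \<open>\<eta>\<close>, and the flip probability is that of an odd Poisson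
  variable with mean \<open>\<eta>\<close>.
\<close>

definition walk_moment :: "real \<Rightarrow> nat \<Rightarrow> nat \<Rightarrow> real" where
  "walk_moment \<eta> m j = flip_exp ((1 - exp (- 2 * \<eta>)) / 2) j (\<lambda>bs. (\<eta> * walk 1 bs) ^ m)"

definition walk_vel_moment :: "real \<Rightarrow> nat \<Rightarrow> nat \<Rightarrow> real" where
  "walk_vel_moment \<eta> m j =
     flip_exp ((1 - exp (- 2 * \<eta>)) / 2) j (\<lambda>bs. walk_vel 1 bs * (\<eta> * walk 1 bs) ^ m)"

lemma flip_prob_bounds:
  assumes "\<eta> \<ge> 0"
  shows "0 \<le> (1 - exp (- 2 * \<eta>)) / 2" "(1 - exp (- 2 * \<eta>)) / 2 \<le> (1 :: real)"
  using assms exp_ge_zero[of "- 2 * \<eta>"] by (simp_all del: exp_ge_zero)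

lemma power_quadratic_bound:
  obtains C where "C \<ge> 0"
    "\<And>a b. \<bar>a\<bar> \<le> R \<Longrightarrow> \<bar>b\<bar> \<le> R \<Longrightarrow>
       \<bar>b ^ m - a ^ m - (b - a) * (real m * a ^ (m - 1))\<bar> \<le> C * (b - a :: real)\<^sup>2"
proof (rule taylor_quadratic_bound)
  show "((\<lambda>x::real. x ^ m) has_real_derivative real m * x ^ (m - 1)) (at x)" for x
    by (auto intro!: derivative_eq_intros)
  show "((\<lambda>x::real. real m * x ^ (m - 1)) has_real_derivative
      real m * (real (m - 1) * x ^ (m - 1 - 1))) (at x)" for x
    by (auto intro!: derivative_eq_intros)
  show "continuous_on UNIV (\<lambda>x::real. real m * (real (m - 1) * x ^ (m - 1 - 1)))"
    by (intro continuous_intros)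
qed (use that in blast)

lemma eta_walk_le:
  assumes "\<eta> \<ge> 0" "real (length bs) * \<eta> \<le> x"
  shows "\<bar>\<eta> * walk 1 bs\<bar> \<le> x"
proof -
  have "\<bar>\<eta> * walk 1 bs\<bar> \<le> \<eta> * real (length bs)"
    unfolding abs_mult using assms abs_walk_le[of 1 bs] by (intro mult_mono) auto
  then show ?thesis using assms by (simp add: mult.commute)
qed

text \<open>Expand one step around the position before it. The new velocity has mean sign
  \<open>1 - 2 * p = exp (- 2 * \<eta>)\<close>, which appears where it enters linearly; where it
  enters squared it is 1. At \<open>m = 0\<close> the truncated \<open>m - 1\<close> is multiplied
  by \<open>real m = 0\<close>.\<close>

lemma walk_moment_step:
  assumes "x \<ge> 0"
  obtains C where "C \<ge> 0"
    "\<And>\<eta> j. 0 \<le> \<eta> \<Longrightarrow> \<eta> \<le> x \<Longrightarrow> real j * \<eta> \<le> x \<Longrightarrow>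
      \<bar>walk_moment \<eta> m (Suc j) - (walk_moment \<eta> m j
          + real m * \<eta> * exp (- 2 * \<eta>) * walk_vel_moment \<eta> (m - 1) j)\<bar> \<le> C * \<eta>\<^sup>2"
    "\<And>\<eta> j. 0 \<le> \<eta> \<Longrightarrow> \<eta> \<le> x \<Longrightarrow> real j * \<eta> \<le> x \<Longrightarrow>
      \<bar>walk_vel_moment \<eta> m (Suc j) - (exp (- 2 * \<eta>) * walk_vel_moment \<eta> m j
          + real m * \<eta> * walk_moment \<eta> (m - 1) j)\<bar> \<le> C * \<eta>\<^sup>2"
proof -
  \<comment> \<open>Radius \<open>2 * x\<close>: the position is at most \<open>x\<close> before the
    step and at most \<open>x + \<eta>\<close> after it.\<close>
  obtain C where C: "C \<ge> 0"
    "\<And>a b. \<bar>a\<bar> \<le> 2 * x \<Longrightarrow> \<bar>b\<bar> \<le> 2 * x \<Longrightarrow>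
       \<bar>b ^ m - a ^ m - (b - a) * (real m * a ^ (m - 1))\<bar> \<le> C * (b - a :: real)\<^sup>2"
    using power_quadratic_bound by metis
  show thesis
  proof (rule that[OF C(1)])
    fix \<eta> :: real and j :: nat
    assume \<eta>: "0 \<le> \<eta>" "\<eta> \<le> x" "real j * \<eta> \<le> x"
    define p where "p = (1 - exp (- 2 * \<eta>)) / 2"
    have p: "0 \<le> p" "p \<le> 1" "exp (- 2 * \<eta>) = 1 - 2 * p"
      using flip_prob_bounds[OF \<eta>(1)] by (auto simp: p_def field_simps)
    define r where "r a w = (a + \<eta> * w) ^ m - a ^ m - \<eta> * w * (real m * a ^ (m - 1))" for a w :: real
    have r: "\<bar>r (\<eta> * walk 1 bs) w\<bar> \<le> C * \<eta>\<^sup>2" if "length bs = j" "\<bar>w\<bar> = 1" for bs w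
    proof -
      have a: "\<bar>\<eta> * walk 1 bs\<bar> \<le> x"
        using eta_walk_le[OF \<eta>(1)] that(1) \<eta>(3) by auto
      have "\<bar>\<eta> * w\<bar> = \<eta>" using that(2) \<eta>(1) by (simp add: abs_mult)
      moreover have "(\<eta> * w)\<^sup>2 = \<eta>\<^sup>2"
        using that(2) by (metis calculation power2_abs)
      ultimately show ?thesis
        using C(2)[of "\<eta> * walk 1 bs" "\<eta> * walk 1 bs + \<eta> * w"] a \<eta>(2) by (simp add: r_def)
    qed
    \<comment> \<open>The signs \<open>s\<close> and \<open>t\<close> serve both recursions: 1 and 1
      for the position, \<open>v\<close> and \<open>- v\<close> for the velocity-weighted
      moment.\<close>
    have r2: "\<bar>(1 - p) * (s * r (\<eta> * walk 1 bs) w) + p * (t * r (\<eta> * walk 1 bs) (- w))\<bar> \<le> C * \<eta>\<^sup>2"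
      if "length bs = j" "\<bar>w\<bar> = 1" "\<bar>s\<bar> = 1" "\<bar>t\<bar> = 1" for bs w s t
    proof -
      have "\<bar>s * r (\<eta> * walk 1 bs) w\<bar> \<le> C * \<eta>\<^sup>2" "\<bar>t * r (\<eta> * walk 1 bs) (- w)\<bar> \<le> C * \<eta>\<^sup>2"
        using r that by (auto simp: abs_mult)
      then have "\<bar>(1 - p) * (s * r (\<eta> * walk 1 bs) w)\<bar> + \<bar>p * (t * r (\<eta> * walk 1 bs) (- w))\<bar>
          \<le> (1 - p) * (C * \<eta>\<^sup>2) + p * (C * \<eta>\<^sup>2)"
        using p by (intro add_mono abs_mult_le[of _ "1 - p"] abs_mult_le[of _ p]) simp_all
      then show ?thesis by (simp add: algebra_simps)
    qed
    have vel: "\<bar>walk_vel 1 bs\<bar> = 1" for bs by (simp add: abs_walk_vel)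
    have sq: "walk_vel 1 bs * walk_vel 1 bs = 1" for bs
      using vel[of bs] by (metis abs_mult_self_eq mult_1)
    have "\<bar>walk_moment \<eta> m (Suc j) - flip_exp p j (\<lambda>bs. (\<eta> * walk 1 bs) ^ m
        + real m * \<eta> * (1 - 2 * p) * (walk_vel 1 bs * (\<eta> * walk 1 bs) ^ (m - 1)))\<bar> \<le> C * \<eta>\<^sup>2"
      unfolding walk_moment_def flip_exp_snoc p_def[symmetric]
    proof (rule flip_exp_abs_diff_le[OF p(1,2)], goal_cases)
      case (1 bs)
      show ?case
        using r2[OF 1 vel[of bs], of 1 1]
        by (simp add: r_def algebra_simps)
    qed
    then show "\<bar>walk_moment \<eta> m (Suc j) - (walk_moment \<eta> m j
          + real m * \<eta> * exp (- 2 * \<eta>) * walk_vel_moment \<eta> (m - 1) j)\<bar> \<le> C * \<eta>\<^sup>2"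
      unfolding walk_vel_moment_def walk_moment_def p_def[symmetric] unfolding p(3)
      by (simp only: flip_exp_add flip_exp_cmult)
    have "\<bar>walk_vel_moment \<eta> m (Suc j) - flip_exp p j (\<lambda>bs. (1 - 2 * p) * (walk_vel 1 bs * (\<eta> * walk 1 bs) ^ m)
        + real m * \<eta> * (\<eta> * walk 1 bs) ^ (m - 1))\<bar> \<le> C * \<eta>\<^sup>2"
      unfolding walk_vel_moment_def flip_exp_snoc p_def[symmetric]
    proof (rule flip_exp_abs_diff_le[OF p(1,2)], goal_cases)
      case (1 bs)
      define v a where "v = walk_vel 1 bs" and "a = \<eta> * walk 1 bs"
      have "(1 - p) * (v * (a + \<eta> * v) ^ m) + p * (- v * (a + \<eta> * (- v)) ^ m)
          - ((1 - 2 * p) * (v * a ^ m) + real m * \<eta> * a ^ (m - 1))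
        = (1 - p) * (v * r a v) + p * (- v * r a (- v))
          + (v * v - 1) * (real m * \<eta> * a ^ (m - 1))"
        by (simp add: r_def algebra_simps)
      then have "(1 - p) * (v * (a + \<eta> * v) ^ m) + p * (- v * (a + \<eta> * (- v)) ^ m)
          - ((1 - 2 * p) * (v * a ^ m) + real m * \<eta> * a ^ (m - 1))
        = (1 - p) * (v * r a v) + p * (- v * r a (- v))"
        using sq[of bs] by (simp add: v_def)
      with r2[OF 1 vel[of bs], of v "- v"] show ?case
        using vel[of bs] by (simp add: v_def a_def distrib_left right_diff_distrib)
    qed
    then show "\<bar>walk_vel_moment \<eta> m (Suc j) - (exp (- 2 * \<eta>) * walk_vel_moment \<eta> m j
          + real m * \<eta> * walk_moment \<eta> (m - 1) j)\<bar> \<le> C * \<eta>\<^sup>2"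
      unfolding walk_vel_moment_def walk_moment_def p_def[symmetric] unfolding p(3)
      by (simp only: flip_exp_add flip_exp_cmult)
  qed
qed

text \<open>Earlier errors are carried over without amplification, so no exponential factor arises:
  \<open>K\<close> local errors \<open>C * \<eta>\<^sup>2\<close> add up to
  \<open>x * C * \<eta>\<close>.\<close>

lemma accumulated_error:
  fixes d :: "nat \<Rightarrow> real"
  assumes "d 0 = 0" "\<And>j. j < K \<Longrightarrow> \<bar>d (Suc j)\<bar> \<le> \<bar>d j\<bar> + C * \<eta>\<^sup>2"
    and "j \<le> K" "real K * \<eta> = x" "C \<ge> 0" "\<eta> \<ge> 0"
  shows "\<bar>d j\<bar> \<le> x * C * \<eta>"
proof -
  have "\<bar>d j\<bar> \<le> real j * (C * \<eta>\<^sup>2)"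
    using assms(3)
  proof (induction j)
    case (Suc j)
    then show ?case using assms(2)[of j] by (simp add: algebra_simps)
  qed (use assms in auto)
  also have "\<dots> \<le> real K * (C * \<eta>\<^sup>2)"
    using assms by (intro mult_right_mono) auto
  also have "\<dots> = x * C * \<eta>"
    using assms(4) by (simp add: power2_eq_square algebra_simps)
  finally show ?thesis .
qed

section \<open>Comparison of discrete and continuous moments\<close>

lemma even_moment_continuous: "continuous_on S (even_moment k)"
proof -
  have "(even_moment k has_real_derivative fact (2 * k) * (exp (- s) * (pair_egf' k s - pair_egf k s))) (at s)" for s
    unfolding even_moment_def[abs_def]
    by (rule derivative_eq_intros pair_egf_derivative refl)+ algebra
  then show ?thesis
    by (meson DERIV_isCont continuous_at_imp_continuous_on)
qed

lemma odd_moment_continuous: "continuous_on S (odd_moment k)"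
  using odd_moment_derivative by (meson DERIV_isCont continuous_at_imp_continuous_on)

lemma even_moment_taylor:
  obtains C where "C \<ge> 0"
    "\<And>s \<eta>. 0 \<le> s \<Longrightarrow> 0 \<le> \<eta> \<Longrightarrow> s + \<eta> \<le> x \<Longrightarrow>
       \<bar>even_moment (Suc k) (s + \<eta>) - even_moment (Suc k) s
          - \<eta> * (real (2 * k + 2) * odd_moment k s)\<bar> \<le> C * \<eta>\<^sup>2"
proof -
  obtain C where C: "C \<ge> 0" "\<And>a b. \<bar>a\<bar> \<le> x \<Longrightarrow> \<bar>b\<bar> \<le> x \<Longrightarrow>
      \<bar>even_moment (Suc k) b - even_moment (Suc k) a - (b - a) * (real (2 * k + 2) * odd_moment k a)\<bar>
        \<le> C * (b - a)\<^sup>2"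
    by (rule taylor_quadratic_bound[OF even_moment_derivative DERIV_cmult[OF odd_moment_derivative]])
       (intro continuous_intros even_moment_continuous odd_moment_continuous, blast)
  show thesis
    by (rule that[OF C(1)]) (use C(2)[of s "s + \<eta>" for s \<eta>] in force)
qed

text \<open>The damping is kept as \<open>exp (- 2 * \<eta>)\<close>, as in the discrete recursion,
  so that the two can be subtracted directly. Passing from its linear part
  \<open>1 - 2 * \<eta>\<close> to it costs the additional constant
  \<open>4 * D * \<bar>G\<bar>\<close>.\<close>

lemma odd_moment_taylor:
  obtains C where "C \<ge> 0"
    "\<And>s \<eta>. 0 \<le> s \<Longrightarrow> 0 \<le> \<eta> \<Longrightarrow> s + \<eta> \<le> x \<Longrightarrow>
       \<bar>odd_moment k (s + \<eta>) - exp (- 2 * \<eta>) * odd_moment k s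
          - \<eta> * (real (2 * k + 1) * even_moment k s)\<bar> \<le> C * \<eta>\<^sup>2"
proof -
  have d: "((\<lambda>s. real (2 * k + 1) * even_moment k s - 2 * odd_moment k s) has_real_derivative
      real (2 * k + 1) * (fact (2 * k) * (exp (- s) * (pair_egf' k s - pair_egf k s)))
        - 2 * (real (2 * k + 1) * even_moment k s - 2 * odd_moment k s)) (at s)" for s
    unfolding even_moment_def[abs_def]
    by (rule derivative_eq_intros odd_moment_derivative pair_egf_derivative refl)+ (unfold even_moment_def, algebra)
  have "\<bar>real ((Suc i div 2) choose j)\<bar> \<le> 2 * 2 ^ i" for i j
    using half_choose_le[of "Suc i" j] by simp
  then have cont: "continuous_on UNIV (pair_egf j)" "continuous_on UNIV (pair_egf' j)" for j
    using pair_egf_derivative egf_derivative[of "\<lambda>i. real ((Suc i div 2) choose j)" 2]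
    unfolding pair_egf'_def by (meson DERIV_isCont continuous_at_imp_continuous_on)+
  obtain C where C: "C \<ge> 0" "\<And>a b. \<bar>a\<bar> \<le> x \<Longrightarrow> \<bar>b\<bar> \<le> x \<Longrightarrow>
      \<bar>odd_moment k b - odd_moment k a
        - (b - a) * (real (2 * k + 1) * even_moment k a - 2 * odd_moment k a)\<bar> \<le> C * (b - a)\<^sup>2"
    by (rule taylor_quadratic_bound[OF odd_moment_derivative d])
       (intro continuous_intros even_moment_continuous odd_moment_continuous cont, blast)
  obtain D where D: "D \<ge> 0" "\<And>a b. \<bar>a\<bar> \<le> 2 * x \<Longrightarrow> \<bar>b\<bar> \<le> 2 * x \<Longrightarrow>
      \<bar>exp b - exp a - (b - a) * exp a\<bar> \<le> D * (b - a :: real)\<^sup>2"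
    by (rule taylor_quadratic_bound[OF DERIV_exp DERIV_exp]) (intro continuous_intros, blast)
  have "bounded (odd_moment k ` {0..x})"
    by (intro compact_imp_bounded compact_continuous_image odd_moment_continuous) auto
  then obtain G where G: "\<And>s. s \<in> {0..x} \<Longrightarrow> \<bar>odd_moment k s\<bar> \<le> G"
    unfolding bounded_iff by (metis image_eqI real_norm_def)
  show thesis
  proof (rule that[of "C + 4 * D * \<bar>G\<bar>"])
    fix s \<eta> :: real
    assume s: "0 \<le> s" "0 \<le> \<eta>" "s + \<eta> \<le> x"
    have 1: "\<bar>odd_moment k (s + \<eta>) - odd_moment k s
        - \<eta> * (real (2 * k + 1) * even_moment k s - 2 * odd_moment k s)\<bar> \<le> C * \<eta>\<^sup>2"
      using C(2)[of s "s + \<eta>"] s by simp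
    have 2: "\<bar>exp (- 2 * \<eta>) - 1 + 2 * \<eta>\<bar> \<le> 4 * D * \<eta>\<^sup>2"
      using D(2)[of 0 "- 2 * \<eta>"] s by (simp add: power2_eq_square)
    have "\<bar>(exp (- 2 * \<eta>) - 1 + 2 * \<eta>) * odd_moment k s\<bar> \<le> (4 * D * \<eta>\<^sup>2) * \<bar>G\<bar>"
      by (rule abs_mult_le[OF 2]) (use G[of s] s in auto)
    moreover have "odd_moment k (s + \<eta>) - exp (- 2 * \<eta>) * odd_moment k s
          - \<eta> * (real (2 * k + 1) * even_moment k s) =
       (odd_moment k (s + \<eta>) - odd_moment k s
        - \<eta> * (real (2 * k + 1) * even_moment k s - 2 * odd_moment k s))
        - (exp (- 2 * \<eta>) - 1 + 2 * \<eta>) * odd_moment k s"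
      by algebra
    ultimately show "\<bar>odd_moment k (s + \<eta>) - exp (- 2 * \<eta>) * odd_moment k s
          - \<eta> * (real (2 * k + 1) * even_moment k s)\<bar> \<le> (C + 4 * D * \<bar>G\<bar>) * \<eta>\<^sup>2"
      using 1 by (simp add: algebra_simps)
  qed (use C D in auto)
qed

lemma walk_vel_moment_bound:
  assumes "\<eta> \<ge> 0" "real j * \<eta> \<le> x" "0 \<le> x"
  shows "\<bar>walk_vel_moment \<eta> m j\<bar> \<le> x ^ m"
proof -
  have "\<bar>walk_vel_moment \<eta> m j - flip_exp ((1 - exp (- 2 * \<eta>)) / 2) j (\<lambda>_. 0)\<bar> \<le> x ^ m"
    unfolding walk_vel_moment_def
  proof (rule flip_exp_abs_diff_le[OF flip_prob_bounds[OF assms(1)]])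
    fix bs :: "bool list" assume "length bs = j"
    then have "\<bar>\<eta> * walk 1 bs\<bar> \<le> x" using eta_walk_le[OF assms(1)] assms(2) by auto
    then show "\<bar>walk_vel 1 bs * (\<eta> * walk 1 bs) ^ m - 0\<bar> \<le> x ^ m"
      by (simp add: abs_mult abs_walk_vel power_abs power_mono)
  qed
  then show ?thesis by simp
qed

lemma even_moment_0: "even_moment 0 s = 1"
  by (simp add: even_moment_def pair_egf_0 exp_minus)

text \<open>The system is triangular: the error at order 2k enters the velocity-weighted moment of
  order 2k+1, and that error enters order 2k+2. The bound covers all grid times
  \<open>j \<le> K\<close>, because errors are summed along the whole path of steps.\<close>

lemma walk_moment_euler:
  assumes x: "x > 0"
  shows "\<exists>C. \<forall>K j. K > 0 \<longrightarrow> j \<le> K \<longrightarrow>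
      \<bar>walk_moment (x / real K) (2 * k) j - even_moment k (real j * (x / real K))\<bar> \<le> C * (x / real K)"
    (is "\<exists>C. ?A C k")
proof (induction k)
  case 0
  then show ?case by (intro exI[of _ 0]) (simp add: walk_moment_def even_moment_0)
next
  case (Suc k)
  then obtain A where A: "?A A k" by blast
  obtain S1 where S1: "S1 \<ge> 0" "\<And>\<eta> j. 0 \<le> \<eta> \<Longrightarrow> \<eta> \<le> x \<Longrightarrow> real j * \<eta> \<le> x \<Longrightarrow>
      \<bar>walk_vel_moment \<eta> (2 * k + 1) (Suc j) - (exp (- 2 * \<eta>) * walk_vel_moment \<eta> (2 * k + 1) j
          + real (2 * k + 1) * \<eta> * walk_moment \<eta> (2 * k) j)\<bar> \<le> S1 * \<eta>\<^sup>2"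
    using walk_moment_step[of x "2 * k + 1"] x by (metis add_diff_cancel_right' less_imp_le)
  obtain S2 where S2: "S2 \<ge> 0" "\<And>\<eta> j. 0 \<le> \<eta> \<Longrightarrow> \<eta> \<le> x \<Longrightarrow> real j * \<eta> \<le> x \<Longrightarrow>
      \<bar>walk_moment \<eta> (2 * k + 2) (Suc j) - (walk_moment \<eta> (2 * k + 2) j
          + real (2 * k + 2) * \<eta> * exp (- 2 * \<eta>) * walk_vel_moment \<eta> (2 * k + 1) j)\<bar> \<le> S2 * \<eta>\<^sup>2"
  proof -
    have "2 * k + 2 - 1 = 2 * k + 1" by simp
    then show thesis using walk_moment_step[of x "2 * k + 2"] x that by (metis less_imp_le)
  qed
  obtain T1 where T1: "T1 \<ge> 0" "\<And>s \<eta>. 0 \<le> s \<Longrightarrow> 0 \<le> \<eta> \<Longrightarrow> s + \<eta> \<le> x \<Longrightarrow>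
       \<bar>odd_moment k (s + \<eta>) - exp (- 2 * \<eta>) * odd_moment k s
          - \<eta> * (real (2 * k + 1) * even_moment k s)\<bar> \<le> T1 * \<eta>\<^sup>2"
    using odd_moment_taylor by metis
  obtain T2 where T2: "T2 \<ge> 0" "\<And>s \<eta>. 0 \<le> s \<Longrightarrow> 0 \<le> \<eta> \<Longrightarrow> s + \<eta> \<le> x \<Longrightarrow>
       \<bar>even_moment (Suc k) (s + \<eta>) - even_moment (Suc k) s
          - \<eta> * (real (2 * k + 2) * odd_moment k s)\<bar> \<le> T2 * \<eta>\<^sup>2"
    using even_moment_taylor by metis
  \<comment> \<open>\<open>B\<close> collects the two local errors and the induction constant
    \<open>A\<close> with its coefficient. The last summand of \<open>D\<close> pays for the factor
    \<open>exp (- 2 * \<eta>)\<close>, which the discrete position recursion has and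
    \<open>even_moment_taylor\<close> has not.\<close>
  define B where "B = x * (S1 + T1 + real (2 * k + 1) * \<bar>A\<bar>)"
  define D where "D = S2 + T2 + real (2 * k + 2) * B + real (2 * k + 2) * 2 * x ^ (2 * k + 1)"
  have B0: "B \<ge> 0" and D0: "D \<ge> 0"
    using x S1 S2 T1 T2 unfolding D_def B_def by (auto intro!: add_nonneg_nonneg mult_nonneg_nonneg)
  have vel_err: "\<bar>walk_vel_moment \<eta> (2 * k + 1) j - odd_moment k (real j * \<eta>)\<bar> \<le> B * \<eta>"
    if K: "K > 0" "j \<le> K" and \<eta>_def: "\<eta> = x / real K" for K j \<eta>
  proof -
    have \<eta>: "0 \<le> \<eta>" "\<eta> \<le> x" "real K * \<eta> = x"
      using K x by (auto simp: \<eta>_def divide_le_eq mult_le_cancel_left1)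
    define d where "d i = walk_vel_moment \<eta> (2 * k + 1) i - odd_moment k (real i * \<eta>)" for i
    have "\<bar>d j\<bar> \<le> x * (S1 + T1 + real (2 * k + 1) * \<bar>A\<bar>) * \<eta>"
    proof (rule accumulated_error[OF _ _ K(2) \<eta>(3)])
      show "d 0 = 0"
        by (simp add: d_def walk_vel_moment_def odd_moment_def pair_egf_at_0)
    next
      fix i assume i: "i < K"
      have i\<eta>: "real (Suc i) * \<eta> \<le> x" "real i * \<eta> \<le> x"
        using i \<eta> mult_right_mono[of "real (Suc i)" "real K" \<eta>] mult_right_mono[of "real i" "real K" \<eta>]
        by auto
      define a where "a = walk_moment \<eta> (2 * k) i - even_moment k (real i * \<eta>)"
      have "\<bar>a\<bar> \<le> A * \<eta>" using A K i by (simp add: a_def \<eta>_def)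
      also have "\<dots> \<le> \<bar>A\<bar> * \<eta>" using \<eta>(1) by (intro mult_right_mono) auto
      finally have a: "\<bar>real (2 * k + 1) * \<eta> * a\<bar> \<le> (real (2 * k + 1) * \<eta>) * (\<bar>A\<bar> * \<eta>)"
        using \<eta>(1) by (intro abs_mult_le) auto
      define e1 where "e1 = walk_vel_moment \<eta> (2 * k + 1) (Suc i)
          - (exp (- 2 * \<eta>) * walk_vel_moment \<eta> (2 * k + 1) i
             + real (2 * k + 1) * \<eta> * walk_moment \<eta> (2 * k) i)"
      define e2 where "e2 = odd_moment k (real i * \<eta> + \<eta>) - exp (- 2 * \<eta>) * odd_moment k (real i * \<eta>)
          - \<eta> * (real (2 * k + 1) * even_moment k (real i * \<eta>))"
      have e: "\<bar>e1\<bar> \<le> S1 * \<eta>\<^sup>2" "\<bar>e2\<bar> \<le> T1 * \<eta>\<^sup>2"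
        using S1(2)[of \<eta> i] T1(2)[of "real i * \<eta>" \<eta>] \<eta> i\<eta>
        by (auto simp: e1_def e2_def algebra_simps)
      have "d (Suc i) = exp (- 2 * \<eta>) * d i + real (2 * k + 1) * \<eta> * a + e1 - e2"
        by (simp add: d_def a_def e1_def e2_def algebra_simps)
      \<comment> \<open>Damping by a factor at most 1 is what prevents growth of the old
        error.\<close>
      moreover have "\<bar>exp (- 2 * \<eta>) * d i\<bar> \<le> 1 * \<bar>d i\<bar>"
        using \<eta>(1) by (intro abs_mult_le) auto
      ultimately have "\<bar>d (Suc i)\<bar> \<le> \<bar>d i\<bar> + (real (2 * k + 1) * \<eta>) * (\<bar>A\<bar> * \<eta>) + S1 * \<eta>\<^sup>2 + T1 * \<eta>\<^sup>2"
        using a e by linarith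
      also have "\<dots> = \<bar>d i\<bar> + (S1 + T1 + real (2 * k + 1) * \<bar>A\<bar>) * \<eta>\<^sup>2"
        by (simp add: power2_eq_square algebra_simps)
      finally show "\<bar>d (Suc i)\<bar> \<le> \<bar>d i\<bar> + (S1 + T1 + real (2 * k + 1) * \<bar>A\<bar>) * \<eta>\<^sup>2" .
    qed (use S1 T1 \<eta> in auto)
    then show ?thesis by (simp add: d_def B_def)
  qed
  have "?A (x * D) (Suc k)"
  proof (intro allI impI)
    fix K j :: nat assume K: "0 < K" "j \<le> K"
    define \<eta> where "\<eta> = x / real K"
    have \<eta>: "0 \<le> \<eta>" "\<eta> \<le> x" "real K * \<eta> = x"
      using K x by (auto simp: \<eta>_def divide_le_eq mult_le_cancel_left1)
    define d where "d i = walk_moment \<eta> (2 * k + 2) i - even_moment (Suc k) (real i * \<eta>)" for i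
    have "\<bar>d j\<bar> \<le> x * D * \<eta>"
    proof (rule accumulated_error[OF _ _ K(2) \<eta>(3)])
      show "d 0 = 0"
        by (simp add: d_def walk_moment_def even_moment_def pair_egf_at_0)
    next
      fix i assume i: "i < K"
      have i\<eta>: "real (Suc i) * \<eta> \<le> x" "real i * \<eta> \<le> x"
        using i \<eta> mult_right_mono[of "real (Suc i)" "real K" \<eta>] mult_right_mono[of "real i" "real K" \<eta>]
        by auto
      define a where "a = walk_vel_moment \<eta> (2 * k + 1) i - odd_moment k (real i * \<eta>)"
      have "\<bar>a\<bar> \<le> B * \<eta>" using vel_err[OF K(1) _ \<eta>_def, of i] i by (simp add: a_def)
      then have a: "\<bar>real (2 * k + 2) * \<eta> * a\<bar> \<le> (real (2 * k + 2) * \<eta>) * (B * \<eta>)"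
        using \<eta>(1) by (intro abs_mult_le) auto
      define b where "b = (exp (- 2 * \<eta>) - 1) * walk_vel_moment \<eta> (2 * k + 1) i"
      have "\<bar>b\<bar> \<le> (2 * \<eta>) * x ^ (2 * k + 1)"
        unfolding b_def using \<eta>(1) exp_ge_add_one_self[of "- 2 * \<eta>"] i\<eta> x
        by (intro abs_mult_le walk_vel_moment_bound) auto
      then have b: "\<bar>real (2 * k + 2) * \<eta> * b\<bar> \<le> (real (2 * k + 2) * \<eta>) * ((2 * \<eta>) * x ^ (2 * k + 1))"
        using \<eta>(1) by (intro abs_mult_le) auto
      define e1 where "e1 = walk_moment \<eta> (2 * k + 2) (Suc i) - (walk_moment \<eta> (2 * k + 2) i
          + real (2 * k + 2) * \<eta> * exp (- 2 * \<eta>) * walk_vel_moment \<eta> (2 * k + 1) i)"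
      define e2 where "e2 = even_moment (Suc k) (real i * \<eta> + \<eta>) - even_moment (Suc k) (real i * \<eta>)
          - \<eta> * (real (2 * k + 2) * odd_moment k (real i * \<eta>))"
      have e: "\<bar>e1\<bar> \<le> S2 * \<eta>\<^sup>2" "\<bar>e2\<bar> \<le> T2 * \<eta>\<^sup>2"
        using S2(2)[of \<eta> i] T2(2)[of "real i * \<eta>" \<eta>] \<eta> i\<eta>
        by (auto simp: e1_def e2_def algebra_simps)
      have "d (Suc i) = d i + real (2 * k + 2) * \<eta> * a + real (2 * k + 2) * \<eta> * b + e1 - e2"
        by (simp add: d_def a_def b_def e1_def e2_def algebra_simps)
      then have "\<bar>d (Suc i)\<bar> \<le> \<bar>d i\<bar> + (real (2 * k + 2) * \<eta>) * (B * \<eta>)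
          + (real (2 * k + 2) * \<eta>) * ((2 * \<eta>) * x ^ (2 * k + 1)) + S2 * \<eta>\<^sup>2 + T2 * \<eta>\<^sup>2"
        using a b e by linarith
      also have "\<dots> = \<bar>d i\<bar> + D * \<eta>\<^sup>2"
        unfolding D_def by algebra
      finally show "\<bar>d (Suc i)\<bar> \<le> \<bar>d i\<bar> + D * \<eta>\<^sup>2" .
    qed (use D0 \<eta> in auto)
    then show "\<bar>walk_moment (x / real K) (2 * Suc k) j - even_moment (Suc k) (real j * (x / real K))\<bar>
        \<le> x * D * (x / real K)"
      by (simp add: d_def \<eta>_def)
  qed
  then show ?case by blast
qed

lemma walk_moment_tendsto:
  assumes x: "x > 0"
  shows "(\<lambda>K. walk_moment (x / real K) (2 * k) K) \<longlonglongrightarrow> even_moment k x"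
proof -
  obtain C where C: "\<And>K j. K > 0 \<Longrightarrow> j \<le> K \<Longrightarrow>
      \<bar>walk_moment (x / real K) (2 * k) j - even_moment k (real j * (x / real K))\<bar> \<le> C * (x / real K)"
    using walk_moment_euler[OF x] by blast
  have "(\<lambda>K. walk_moment (x / real K) (2 * k) K - even_moment k x) \<longlonglongrightarrow> 0"
  proof (rule Lim_null_comparison)
    show "\<forall>\<^sub>F K in sequentially. norm (walk_moment (x / real K) (2 * k) K - even_moment k x) \<le> C * (x / real K)"
      using eventually_gt_at_top[of 0]
      by eventually_elim (use C[of K K for K] in auto)
    show "(\<lambda>K. C * (x / real K)) \<longlonglongrightarrow> 0"
      by real_asymp
  qed
  then show ?thesis by (simp add: LIM_zero_iff)
qed

section \<open>Absolute moments and Bessel functions\<close>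

text \<open>
  The \<open>r\<close>-th moment of the Beta law with parameters \<open>1/2\<close> and \<open>\<lceil>n/2\<rceil>\<close>. For \<open>n = 0\<close> the value is
  \<open>1\<close>, as for the point mass at \<open>1\<close>.
\<close>

definition beta_moment :: "nat \<Rightarrow> real \<Rightarrow> real" where
  "beta_moment n r = Gamma (1/2 + r) * Gamma (1/2 + real ((n + 1) div 2)) /
     (Gamma (1/2) * Gamma (1/2 + r + real ((n + 1) div 2)))"

lemma Gamma_real_nonzero: "x > 0 \<Longrightarrow> Gamma (x :: real) \<noteq> 0"
  by (metis Gamma_real_pos less_irrefl)

lemma beta_moment_0: "r \<ge> 0 \<Longrightarrow> beta_moment 0 r = 1"
  by (simp add: beta_moment_def Gamma_real_nonzero)

lemma beta_moment_eq_Beta: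
  assumes "n > 0" "r \<ge> 0"
  shows "beta_moment n r = Beta (1/2 + r) (real ((n + 1) div 2)) / Beta (1/2) (real ((n + 1) div 2))"
proof -
  define b where "b = real ((n + 1) div 2)"
  have "b > 0" using assms(1) by (simp add: b_def div_greater_zero_iff)
  then have "Gamma b \<noteq> 0"
    by (rule Gamma_real_nonzero)
  then show ?thesis
    unfolding beta_moment_def Beta_def b_def[symmetric] by simp
qed

text \<open>Averaging over a probability law preserves a uniform bound. For \<open>n > 0\<close> the
  law has the normalised Beta density; for \<open>n = 0\<close> the second parameter is 0, no
  density exists, and the bound is read off at the point mass \<open>y = 1\<close>.\<close>

lemma beta_moment_approx:
  assumes r: "r \<ge> 0"
    and approx: "\<And>y. y \<in> {0..1} \<Longrightarrow> \<bar>y powr r - (\<Sum>i\<le>d. a i * y ^ i)\<bar> \<le> e"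
  shows "\<bar>beta_moment n r - (\<Sum>i\<le>d. a i * beta_moment n (real i))\<bar> \<le> e"
proof (cases "n = 0")
  case True
  then show ?thesis using approx[of 1] r by (simp add: beta_moment_0)
next
  case False
  define b where "b = real ((n + 1) div 2)"
  have b: "b > 0" using False by (simp add: b_def div_greater_zero_iff)
  define w where "w y = y powr (1/2 - 1) * (1 - y) powr (b - 1)" for y :: real
  have pow: "((\<lambda>y. w y * y powr s) has_integral Beta (1/2 + s) b) {0..1}" if "s \<ge> 0" for s
  proof (rule has_integral_eq[OF _ has_integral_Beta_real])
    show "y powr (1/2 + s - 1) * (1 - y) powr (b - 1) = w y * y powr s" for y
      by (simp add: w_def powr_add[symmetric] mult_ac diff_add_eq)
  qed (use that b in auto)
  have pow_nat: "((\<lambda>y. w y * y ^ i) has_integral Beta (1/2 + real i) b) {0..1}" for i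
  proof (rule has_integral_eq[OF _ pow])
    show "w y * y powr real i = w y * y ^ i" if "y \<in> {0..1}" for y
      \<comment> \<open>At \<open>y = 0\<close> the two powers differ for \<open>i = 0\<close>, but
        the weight is 0 there, as \<open>powr\<close> with base 0 is 0.\<close>
      using that by (cases "y = 0") (auto simp: w_def powr_realpow)
  qed auto
  have "((\<lambda>y. w y * y powr r - (\<Sum>i\<le>d. a i * (w y * y ^ i))) has_integral
      Beta (1/2 + r) b - (\<Sum>i\<le>d. a i * Beta (1/2 + real i) b)) {0..1}"
    by (intro has_integral_diff pow r has_integral_sum has_integral_mult_right pow_nat) auto
  then have diff: "((\<lambda>y. w y * (y powr r - (\<Sum>i\<le>d. a i * y ^ i))) has_integral
      Beta (1/2 + r) b - (\<Sum>i\<le>d. a i * Beta (1/2 + real i) b)) {0..1}"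
    by (simp add: right_diff_distrib sum_distrib_left mult.left_commute)
  have const: "((\<lambda>y. w y * e) has_integral Beta (1/2) b * e) {0..1}"
    using has_integral_mult_left[OF pow_nat[of 0], of e] by simp
  have w0: "w y \<ge> 0" for y by (simp add: w_def)
  have "norm (Beta (1/2 + r) b - (\<Sum>i\<le>d. a i * Beta (1/2 + real i) b)) \<le> Beta (1/2) b * e"
  proof -
    have 1: "Beta (1/2 + r) b - (\<Sum>i\<le>d. a i * Beta (1/2 + real i) b) \<le> Beta (1/2) b * e"
      by (rule has_integral_le[OF diff const]) (use w0 approx abs_le_D1 in \<open>blast intro: mult_left_mono\<close>)
    have 2: "- (Beta (1/2) b * e) \<le> Beta (1/2 + r) b - (\<Sum>i\<le>d. a i * Beta (1/2 + real i) b)"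
    proof (rule has_integral_le[OF has_integral_neg[OF const] diff])
      fix y :: real assume "y \<in> {0..1}"
      then have "- e \<le> y powr r - (\<Sum>i\<le>d. a i * y ^ i)"
        using approx[of y] by linarith
      then show "- (w y * e) \<le> w y * (y powr r - (\<Sum>i\<le>d. a i * y ^ i))"
        using mult_left_mono[OF _ w0[of y]] by fastforce
    qed
    from 1 2 show ?thesis by (simp add: abs_le_iff)
  qed
  moreover have B: "Beta (1/2) b > 0"
    using b Gamma_real_pos[of "1/2"] Gamma_real_pos[of b] Gamma_real_pos[of "1/2 + b"]
    by (simp add: Beta_def)
  moreover have "beta_moment n r - (\<Sum>i\<le>d. a i * beta_moment n (real i)) =
      (Beta (1/2 + r) b - (\<Sum>i\<le>d. a i * Beta (1/2 + real i) b)) / Beta (1/2) b"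
    using False r by (simp add: beta_moment_eq_Beta b_def diff_divide_distrib sum_divide_distrib)
  ultimately show ?thesis
    by (simp add: divide_le_eq mult.commute)
qed

text \<open>The zero polynomial is within 1 of \<open>y powr r\<close> on the unit interval.\<close>

lemma beta_moment_le_1:
  assumes "r \<ge> 0"
  shows "\<bar>beta_moment n r\<bar> \<le> 1"
  using beta_moment_approx[OF assms, where d = 0 and a = "\<lambda>_. 0" and e = 1 and n = n] by (simp add: powr_le1 assms)

section \<open>Poisson mixtures and their integer moments\<close>

definition poisson_mean :: "real \<Rightarrow> (nat \<Rightarrow> real) \<Rightarrow> real" where
  "poisson_mean x f = (\<Sum>n. exp (- x) * x ^ n / fact n * f n)"

lemma poisson_weight_sums: "(\<lambda>n. exp (- x) * x ^ n / fact n) sums 1"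
  for x :: real
proof -
  have "(\<lambda>n. exp (- x) * (x ^ n /\<^sub>R fact n)) sums (exp (- x) * exp x)"
    by (intro sums_mult exp_converges)
  then show ?thesis by (simp add: divide_inverse mult_ac exp_minus)
qed

lemma poisson_mean_summable:
  fixes x :: real
  assumes "x \<ge> 0" "\<And>n. \<bar>f n\<bar> \<le> C"
  shows "summable (\<lambda>n. exp (- x) * x ^ n / fact n * f n)"
proof (rule summable_comparison_test')
  show "summable (\<lambda>n. exp (- x) * x ^ n / fact n * C)"
    using sums_summable[OF poisson_weight_sums[of x]] by (rule summable_mult2)
  show "norm (exp (- x) * x ^ n / fact n * f n) \<le> exp (- x) * x ^ n / fact n * C" if "n \<ge> 0" for n
    unfolding norm_mult using assms by (intro mult_mono) (auto simp: abs_mult)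
qed

lemma poisson_mean_abs_diff_le:
  assumes "x \<ge> 0" "\<And>n. \<bar>f n\<bar> \<le> C" "\<And>n. \<bar>g n\<bar> \<le> D" "\<And>n. \<bar>f n - g n\<bar> \<le> e"
  shows "\<bar>poisson_mean x f - poisson_mean x g\<bar> \<le> e"
proof -
  let ?w = "\<lambda>n. exp (- x) * x ^ n / fact n"
  have "poisson_mean x f - poisson_mean x g = (\<Sum>n. ?w n * (f n - g n))"
    unfolding poisson_mean_def
    using suminf_diff[OF poisson_mean_summable[OF assms(1,2)] poisson_mean_summable[OF assms(1,3)]]
    by (simp add: right_diff_distrib)
  also have "norm \<dots> \<le> (\<Sum>n. ?w n * e)"
  proof (rule norm_suminf_le)
    show "norm (?w n * (f n - g n)) \<le> ?w n * e" for n
      unfolding norm_mult using assms by (intro mult_mono) (auto simp: abs_mult)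
    show "summable (\<lambda>n. ?w n * e)"
      using sums_summable[OF poisson_weight_sums[of x]] by (rule summable_mult2)
  qed
  also have "\<dots> = e"
    using sums_unique[OF sums_mult2[OF poisson_weight_sums, of x e]] by simp
  finally show ?thesis by simp
qed

text \<open>Converts Gamma quotients into the binomials of \<open>pair_egf\<close>: for i = n + 2k
  one has i div 2 = n div 2 + k. The induction rests on Gamma(z + 1) = z Gamma(z), and the parities
  of \<open>n\<close> are separated because \<open>(n + 1) div 2\<close> rounds up.\<close>

lemma beta_moment_nat:
  "beta_moment n (real k) = fact (2 * k) * fact n * real ((n div 2 + k) choose k) / fact (n + 2 * k)"
proof (induction k)
  case 0
  then show ?case by (simp add: beta_moment_def Gamma_real_nonzero add_pos_nonneg)
next
  case (Suc k)
  define b where "b = (n + 1) div 2"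
  have G: "Gamma (1/2 + real (Suc k)) = (1/2 + real k) * Gamma (1/2 + real k)"
      "Gamma (1/2 + real (Suc k) + real b) = (1/2 + real k + real b) * Gamma (1/2 + real k + real b)"
    using Gamma_plus1[of "1/2 + real k"] Gamma_plus1[of "1/2 + real k + real b"]
    by (auto simp: add_ac nonpos_Ints_def)
  have "beta_moment n (real (Suc k)) = (1/2 + real k) / (1/2 + real k + real b) * beta_moment n (real k)"
    unfolding beta_moment_def b_def[symmetric] G by (simp add: mult_ac)
  also have "(1/2 + real k) / (1/2 + real k + real b) =
      real (2 * k + 1) * real (2 * k + 2) * real (n div 2 + k + 1)
        / (real (k + 1) * real (n + 2 * k + 1) * real (n + 2 * k + 2))"
  proof (cases "even n")
    case True
    then obtain j where "n = 2 * j" by blast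
    then show ?thesis by (simp add: b_def divide_simps) (simp add: algebra_simps)
  next
    case False
    then obtain j where "n = 2 * j + 1" using oddE by blast
    then show ?thesis by (simp add: b_def divide_simps) (simp add: algebra_simps)
  qed
  finally have step: "beta_moment n (real (Suc k)) =
      real (2 * k + 1) * real (2 * k + 2) * real (n div 2 + k + 1)
        / (real (k + 1) * real (n + 2 * k + 1) * real (n + 2 * k + 2)) *
      (fact (2 * k) * fact n * real ((n div 2 + k) choose k) / fact (n + 2 * k))"
    unfolding Suc.IH .
  have c: "real (k + 1) * real ((n div 2 + Suc k) choose Suc k) =
      real (n div 2 + k + 1) * real ((n div 2 + k) choose k)"
    using Suc_times_binomial_eq[of "n div 2 + k" k]
    by (metis Suc_eq_plus1 add_Suc_right mult.commute of_nat_mult)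
  have f: "fact (2 * Suc k) = real (2 * k + 1) * real (2 * k + 2) * fact (2 * k)"
      "fact (n + 2 * Suc k) = real (n + 2 * k + 1) * real (n + 2 * k + 2) * fact (n + 2 * k)"
    by (simp_all add: algebra_simps)
  have c': "real ((n div 2 + Suc k) choose Suc k) =
      real (n div 2 + k + 1) * real ((n div 2 + k) choose k) / real (k + 1)"
    using c by (simp add: field_simps del: of_nat_add of_nat_Suc binomial_Suc_Suc)
  show ?case
    unfolding step f c' by (simp add: mult_ac)
qed

text \<open>Terms with i < 2k vanish since i div 2 < k. After the shift by 2k,
  \<open>beta_moment_nat\<close> trades (n + 2k)! for (2k)! n!, which restores the Poisson weight of
  n.\<close>

lemma even_moment_eq_poisson_mean:
  assumes x: "x > 0"
  shows "even_moment k x = x ^ (2 * k) * poisson_mean x (\<lambda>n. beta_moment n (real k))"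
proof -
  define c where "c i = real ((i div 2) choose k) / fact i * x ^ i" for i
  have "summable c"
    unfolding c_def by (rule summable_egf[of _ 1]) (use half_choose_le in auto)
  then have "pair_egf k x = (\<Sum>n. c (n + 2 * k)) + (\<Sum>i<2 * k. c i)"
    unfolding pair_egf_def egf_def c_def[symmetric] by (rule suminf_split_initial_segment)
  also have "(\<Sum>i<2 * k. c i) = 0"
    by (intro sum.neutral) (auto simp: c_def)
  also have "c (n + 2 * k) = x ^ (2 * k) / (fact (2 * k) * exp (- x)) *
      (exp (- x) * x ^ n / fact n * beta_moment n (real k))" for n
    by (simp add: c_def beta_moment_nat power_add add.commute)
  then have "(\<Sum>n. c (n + 2 * k)) = x ^ (2 * k) / (fact (2 * k) * exp (- x)) *
      poisson_mean x (\<lambda>n. beta_moment n (real k))"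
    unfolding poisson_mean_def
    by (simp only:) (rule suminf_mult, rule poisson_mean_summable[of _ _ 1],
      use beta_moment_le_1 x in auto)
  finally show ?thesis by (simp add: even_moment_def)
qed

text \<open>Polynomials in S^2 / K^2 converge by the even moments. Replacing
  \<open>y powr r\<close>, continuous at 0 as \<open>r > 0\<close>, by a polynomial costs e/4 for
  the walk and e/4 for the mixture; the convergence itself costs another e/4.\<close>

lemma walk_power_limit:
  assumes x: "x > 0" and r: "r > 0"
  shows "(\<lambda>K. flip_exp ((1 - exp (- 2 * (x / real K))) / 2) K (\<lambda>bs. ((walk 1 bs / real K)\<^sup>2) powr r))
    \<longlonglongrightarrow> poisson_mean x (\<lambda>n. beta_moment n r)" (is "?L (\<lambda>y. y powr r) \<longlonglongrightarrow> ?P r")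
proof -
  let ?y = "\<lambda>K bs. (walk 1 bs / real K)\<^sup>2"
  let ?p = "\<lambda>K. (1 - exp (- 2 * (x / real K))) / 2"
  have lim_nat: "(\<lambda>K. flip_exp (?p K) K (\<lambda>bs. ?y K bs ^ k)) \<longlonglongrightarrow> ?P (real k)" for k
  proof -
    have "(\<lambda>K. walk_moment (x / real K) (2 * k) K / x ^ (2 * k)) \<longlonglongrightarrow> even_moment k x / x ^ (2 * k)"
      by (intro tendsto_divide walk_moment_tendsto x tendsto_const) (use x in auto)
    moreover have "walk_moment (x / real K) (2 * k) K / x ^ (2 * k) = flip_exp (?p K) K (\<lambda>bs. ?y K bs ^ k)" for K
    proof -
      have "(\<lambda>bs. (x / real K * walk 1 bs) ^ (2 * k)) = (\<lambda>bs. x ^ (2 * k) * ?y K bs ^ k)"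
        by (rule ext) (simp only: power_mult power_mult_distrib[symmetric], simp add: mult.commute)
      then show ?thesis
        using x by (simp add: walk_moment_def flip_exp_cmult)
    qed
    ultimately show ?thesis
      using x by (simp add: even_moment_eq_poisson_mean)
  qed
  have p: "0 \<le> ?p K" "?p K \<le> 1" for K
    using flip_prob_bounds[of "x / real K"] x by auto
  show ?thesis
  proof (rule LIMSEQ_I)
    fix e :: real assume e: "e > 0"
    have "continuous_on {0..1} (\<lambda>y::real. y powr r)"
      using r by (intro continuous_intros continuous_on_powr') auto
    then obtain q where q: "real_polynomial_function q" "\<And>y. y \<in> {0..1} \<Longrightarrow> \<bar>y powr r - q y\<bar> < e / 4"
      using Stone_Weierstrass_real_polynomial_function[of "{0..1}" "\<lambda>y. y powr r" "e / 4"] e by auto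
    from q(1) obtain a d where "q = (\<lambda>y. \<Sum>i\<le>d. a i * y ^ i)"
      unfolding real_polynomial_function_iff_sum by blast
    then have q': "\<bar>y powr r - (\<Sum>i\<le>d. a i * y ^ i)\<bar> \<le> e / 4" if "y \<in> {0..1}" for y
      using q(2)[OF that] by simp
    define Q where "Q n = (\<Sum>i\<le>d. a i * beta_moment n (real i))" for n
    have bm: "\<bar>beta_moment n r - Q n\<bar> \<le> e / 4" for n
      unfolding Q_def by (rule beta_moment_approx) (use r q' in auto)
    have "\<bar>?P r - poisson_mean x Q\<bar> \<le> e / 4"
    proof (rule poisson_mean_abs_diff_le)
      show *: "\<bar>beta_moment n r\<bar> \<le> 1" for n using r by (simp add: beta_moment_le_1)
      show "\<bar>Q n\<bar> \<le> 1 + e / 4" for n using bm[of n] *[of n] by linarith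
    qed (use x bm in auto)
    moreover have "poisson_mean x Q = (\<Sum>i\<le>d. a i * ?P (real i))"
    proof -
      have s: "summable (\<lambda>n. exp (- x) * x ^ n / fact n * beta_moment n (real i))" for i
        by (rule poisson_mean_summable[of _ _ 1]) (use x beta_moment_le_1 in auto)
      have "poisson_mean x Q = (\<Sum>n. \<Sum>i\<le>d. a i * (exp (- x) * x ^ n / fact n * beta_moment n (real i)))"
        unfolding poisson_mean_def Q_def by (simp add: sum_distrib_left mult_ac)
      also have "\<dots> = (\<Sum>i\<le>d. \<Sum>n. a i * (exp (- x) * x ^ n / fact n * beta_moment n (real i)))"
        by (rule suminf_sum) (intro summable_mult s)
      also have "\<dots> = (\<Sum>i\<le>d. a i * ?P (real i))"
        unfolding poisson_mean_def by (intro sum.cong refl suminf_mult s)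
      finally show ?thesis .
    qed
    ultimately have 1: "\<bar>?P r - (\<Sum>i\<le>d. a i * ?P (real i))\<bar> \<le> e / 4" by simp
    have lim: "(\<lambda>K. \<Sum>i\<le>d. a i * flip_exp (?p K) K (\<lambda>bs. ?y K bs ^ i)) \<longlonglongrightarrow> (\<Sum>i\<le>d. a i * ?P (real i))"
      by (intro tendsto_intros lim_nat)
    obtain K0 where K0: "\<And>K. K \<ge> K0 \<Longrightarrow>
        \<bar>(\<Sum>i\<le>d. a i * flip_exp (?p K) K (\<lambda>bs. ?y K bs ^ i)) - (\<Sum>i\<le>d. a i * ?P (real i))\<bar> < e / 4"
      using LIMSEQ_D[OF lim, of "e / 4"] e unfolding real_norm_def by auto
    have "norm (flip_exp (?p K) K (\<lambda>bs. ?y K bs powr r) - ?P r) < e" if K: "K \<ge> Suc K0" for K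
    proof -
      have "\<bar>flip_exp (?p K) K (\<lambda>bs. ?y K bs powr r) - flip_exp (?p K) K (\<lambda>bs. \<Sum>i\<le>d. a i * ?y K bs ^ i)\<bar> \<le> e / 4"
      proof (rule flip_exp_abs_diff_le[OF p])
        fix bs :: "bool list" assume "length bs = K"
        then have "\<bar>walk 1 bs / real K\<bar> \<le> 1"
          using abs_walk_le[of 1 bs] K by simp
        then have "?y K bs \<in> {0..1}" by (simp add: abs_square_le_1 del: power_divide)
        then show "\<bar>?y K bs powr r - (\<Sum>i\<le>d. a i * ?y K bs ^ i)\<bar> \<le> e / 4" by (rule q')
      qed
      moreover have "flip_exp (?p K) K (\<lambda>bs. \<Sum>i\<le>d. a i * ?y K bs ^ i) =
          (\<Sum>i\<le>d. a i * flip_exp (?p K) K (\<lambda>bs. ?y K bs ^ i))"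
        by (simp only: flip_exp_sum flip_exp_cmult)
      ultimately show ?thesis using K0[of K] K 1 e unfolding real_norm_def by linarith
    qed
    then show "\<exists>no. \<forall>K\<ge>no. norm (flip_exp (?p K) K (\<lambda>bs. ?y K bs powr r) - ?P r) < e"
      by blast
  qed
qed

lemma walk_max_moment_limit:
  assumes x: "x > 0" and m: "m \<ge> 1"
  shows "(\<lambda>K. flip_exp ((1 - exp (- 2 * (x / real K))) / 2) K (\<lambda>bs. (walk_max 1 bs / real K) ^ m))
    \<longlonglongrightarrow> poisson_mean x (\<lambda>n. beta_moment n (real m / 2))"
proof -
  let ?p = "\<lambda>K. (1 - exp (- 2 * (x / real K))) / 2"
  have pw: "((walk 1 bs / real K)\<^sup>2) powr (real m / 2) = (\<bar>walk 1 bs\<bar> / real K) ^ m" for K bs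
  proof -
    have "(u\<^sup>2) powr (real m / 2) = \<bar>u\<bar> ^ m" for u :: real
    proof (cases "u = 0")
      case False
      then have "(u\<^sup>2) powr (real m / 2) = (\<bar>u\<bar> powr 2) powr (real m / 2)"
        by (simp add: powr_numeral)
      also have "\<dots> = \<bar>u\<bar> ^ m"
        using False by (simp only: powr_powr) (simp add: powr_realpow)
      finally show ?thesis .
    \<comment> \<open>At \<open>u = 0\<close> both sides are 0, the right one because
      \<open>m \<ge> 1\<close>.\<close>
    qed (use m in auto)
    then show ?thesis by simp
  qed
  have 1: "(\<lambda>K. flip_exp (?p K) K (\<lambda>bs. (\<bar>walk 1 bs\<bar> / real K) ^ m))
      \<longlonglongrightarrow> poisson_mean x (\<lambda>n. beta_moment n (real m / 2))"
    using walk_power_limit[OF x, of "real m / 2"] m unfolding pw by simp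
  have 2: "(\<lambda>K. flip_exp (?p K) K (\<lambda>bs. (walk_max 1 bs / real K) ^ m)
      - flip_exp (?p K) K (\<lambda>bs. (\<bar>walk 1 bs\<bar> / real K) ^ m)) \<longlonglongrightarrow> 0"
  proof (rule Lim_null_comparison)
    show "\<forall>\<^sub>F K in sequentially. norm (flip_exp (?p K) K (\<lambda>bs. (walk_max 1 bs / real K) ^ m)
      - flip_exp (?p K) K (\<lambda>bs. (\<bar>walk 1 bs\<bar> / real K) ^ m)) \<le> real m / real K"
      using eventually_gt_at_top[of 0]
    proof eventually_elim
      case (elim K)
      then have "x / real K > 0" using x by simp
      then have "0 < ?p K" "?p K \<le> 1" using flip_prob_bounds[of "x / real K"] by auto
      then show ?case using walk_max_moment_diff[of "?p K" K m] elim by simp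
    qed
    show "(\<lambda>K. real m / real K) \<longlonglongrightarrow> 0" by real_asymp
  qed
  from tendsto_add[OF 2 1] show ?thesis by simp
qed

section \<open>Identification of the Bessel series\<close>

lemma Gamma_half_nat: "Gamma (1/2 + real j) / Gamma (1/2) = fact (2 * j) / (4 ^ j * fact j)"
proof (induction j)
  case (Suc j)
  have "Gamma (1/2 + real (Suc j)) = (1/2 + real j) * Gamma (1/2 + real j)"
    using Gamma_plus1[of "1/2 + real j"] by (auto simp: add_ac nonpos_Ints_def)
  then have "Gamma (1/2 + real (Suc j)) / Gamma (1/2 :: real) = (1/2 + real j) * (fact (2 * j) / (4 ^ j * fact j))"
    unfolding Suc.IH[symmetric] by (simp only: times_divide_eq_right)
  also have "\<dots> = fact (2 * Suc j) / (4 ^ Suc j * fact (Suc j))"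
    by (simp add: divide_simps) (simp add: algebra_simps)
  finally show ?case .
qed (simp add: Gamma_real_nonzero)

text \<open>By \<open>Gamma_half_nat\<close> the factorial of the Poisson weight cancels, leaving
  (x/2)^(2j) / (j! Gamma(j + a)) for n = 2j and (x/2)^(2j+1) / (j! Gamma(j + a + 1)) for n = 2j + 1.
  Both differ from Bessel terms by the same power (x/2)^(a-1), hence the common prefactor
  \<open>(2 / x) powr (a - 1)\<close>.\<close>

lemma poisson_mean_bessel:
  assumes x: "x > 0" and m: "m \<ge> 1"
  shows "poisson_mean x (\<lambda>n. beta_moment n (real m / 2)) =
    exp (- x) * (2 / x) powr ((real m - 1) / 2) * Gamma ((real m + 1) / 2)
      * (bessel_I ((real m - 1) / 2) x + bessel_I ((real m + 1) / 2) x)"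
proof -
  define a where "a = (real m + 1) / 2"
  have a: "a > 0" "(real m - 1) / 2 = a - 1" "1/2 + real m / 2 = a"
    by (auto simp: a_def field_simps)
  define f where "f n = exp (- x) * x ^ n / fact n * beta_moment n (real m / 2)" for n
  define B where "B \<nu> j = (x / 2) powr (2 * real j + \<nu>) / (fact j * Gamma (real j + \<nu> + 1))" for \<nu> j
  define c where "c = exp (- x) * (2 / x) powr (a - 1) * Gamma a"
  have c: "c > 0" using x a by (simp add: c_def)
  have even: "f (2 * j) = c * B (a - 1) j" for j
  proof -
    have "(2 / x) powr (a - 1) * (x / 2) powr (2 * real j + (a - 1)) = (x / 2) ^ (2 * j)"
      using x by (simp add: powr_add powr_divide powr_realpow[symmetric])
    moreover have "f (2 * j) = exp (- x) * (x / 2) ^ (2 * j) * Gamma a / (fact j * Gamma (real j + a))"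
    proof -
      have "beta_moment (2 * j) (real m / 2) =
          Gamma a / Gamma (real j + a) * (Gamma (1/2 + real j) / Gamma (1/2))"
        unfolding beta_moment_def a(3) by (simp add: add.commute)
      moreover have "(4 :: real) ^ j = 2 ^ (2 * j)"
        by (simp add: power_mult)
      ultimately show ?thesis
        unfolding Gamma_half_nat f_def by (simp add: power_divide mult.commute)
    qed
    ultimately show ?thesis
      by (simp add: c_def B_def mult_ac)
  qed
  have odd: "f (2 * j + 1) = c * B a j" for j
  proof -
    have p1: "(2 / x) powr (a - 1) * (x / 2) powr (2 * real j + a) = (x / 2) ^ (2 * j + 1)"
    proof -
      have "(x / 2) powr (2 * real j + a) = (x / 2) powr (a - 1) * (x / 2) powr real (2 * j + 1)"
        by (subst powr_add[symmetric]) (simp add: algebra_simps)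
      moreover have "(2 / x) powr (a - 1) * (x / 2) powr (a - 1) = 1"
        using x by (simp add: powr_mult[symmetric])
      ultimately show ?thesis using x by (simp only: powr_realpow) (simp add: powr_realpow mult.assoc[symmetric])
    qed
    have p2: "f (2 * j + 1) = exp (- x) * (x / 2) ^ (2 * j + 1) * Gamma a / (fact j * Gamma (real j + a + 1))"
    proof -
      have b: "beta_moment (2 * j + 1) (real m / 2) =
          Gamma a / Gamma (real j + a + 1) * (Gamma (1/2 + real (Suc j)) / Gamma (1/2))"
        unfolding beta_moment_def a(3) by (simp add: add_ac)
      \<comment> \<open>For n = 2j + 1 rounding up gives j + 1; dividing out 2 (j + 1) exposes the
        factorial of n itself.\<close>
      have r: "fact (2 * Suc j) / (4 ^ Suc j * fact (Suc j)) =
          (fact (2 * j + 1) / (2 * 4 ^ j * fact j) :: real)"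
      proof -
        have "(fact (2 * Suc j) :: real) = (2 * real (Suc j)) * fact (2 * j + 1)"
          using fact_Suc[of "2 * j + 1", where 'a = real] by (simp add: algebra_simps)
        moreover have "(4 ^ Suc j * fact (Suc j) :: real) = (2 * real (Suc j)) * (2 * 4 ^ j * fact j)"
          by (simp add: mult_ac)
        ultimately show ?thesis
          by (simp only: mult_divide_mult_cancel_left_if) simp
      qed
      have bm: "beta_moment (2 * j + 1) (real m / 2) =
          Gamma a / Gamma (real j + a + 1) * (fact (2 * j + 1) / (2 * 4 ^ j * fact j))"
        unfolding b Gamma_half_nat r ..
      have e: "(x / 2) ^ (2 * j + 1) = x ^ (2 * j + 1) / (2 * 4 ^ j)"
        by (simp add: power_divide power_mult)
      have cancel: "F \<noteq> 0 \<Longrightarrow> u * v / F * (w / y * (F / (2 * q * z))) = u * (v / (2 * q)) * w / (z * y)"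
        for F u v w y q z :: real
        by (simp add: mult_ac)
      show ?thesis
        unfolding f_def bm e by (rule cancel) (rule fact_nonzero)
    qed
    show ?thesis
      unfolding p2 p1[symmetric] c_def B_def by (simp add: mult_ac)
  qed
  have f0: "f n \<ge> 0" for n
  proof -
    have "Gamma (1/2 + real m / 2) > 0" "Gamma (1/2 + real ((n + 1) div 2)) > 0" "Gamma (1/2 :: real) > 0"
      "Gamma (1/2 + real m / 2 + real ((n + 1) div 2)) > 0"
      by (auto intro!: Gamma_real_pos add_pos_nonneg)
    then show ?thesis using x by (simp add: f_def beta_moment_def)
  qed
  have sf: "summable f"
    unfolding f_def by (rule poisson_mean_summable[of _ _ 1]) (use x beta_moment_le_1 in auto)
  have "(\<lambda>j. sum f {j * 2..<j * 2 + 2}) sums (\<Sum>n. f n)"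
    by (rule sums_group) (use sf summable_sums in auto)
  moreover have "sum f {j * 2..<j * 2 + 2} = f (2 * j) + f (2 * j + 1)" for j
    by (simp add: numeral_2_eq_2 mult.commute)
  ultimately have s: "(\<lambda>j. f (2 * j) + f (2 * j + 1)) sums (\<Sum>n. f n)" by simp
  \<comment> \<open>As all terms are nonnegative, each parity class is dominated by the convergent
    paired series.\<close>
  have se: "summable (\<lambda>j. f (2 * j))" and so: "summable (\<lambda>j. f (2 * j + 1))"
    by (rule summable_comparison_test'[OF sums_summable[OF s], of 0]; use f0 in simp)+
  \<comment> \<open>The Bessel series inherit convergence from the mixture because \<open>c\<close>
    is nonzero.\<close>
  have Bs: "summable (B (a - 1))" "summable (B a)"
    using se so c summable_cmult_iff[of c "B (a - 1)"] summable_cmult_iff[of c "B a"]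
    unfolding even odd by auto
  have "poisson_mean x (\<lambda>n. beta_moment n (real m / 2)) = (\<Sum>j. f (2 * j) + f (2 * j + 1))"
    using sums_unique[OF s] by (simp add: poisson_mean_def f_def)
  also have "\<dots> = (\<Sum>j. f (2 * j)) + (\<Sum>j. f (2 * j + 1))"
    by (rule suminf_add[symmetric, OF se so])
  also have "\<dots> = c * (bessel_I (a - 1) x + bessel_I a x)"
  proof -
    have "bessel_I \<nu> x = (\<Sum>j. B \<nu> j)" for \<nu>
      by (simp add: bessel_I_def B_def)
    then show ?thesis
      unfolding even odd suminf_mult[OF Bs(1)] suminf_mult[OF Bs(2)] by (simp only: distrib_left)
  qed
  finally show ?thesis by (simp add: c_def a(2) a_def[symmetric])
qed

section \<open>From the telegraph process to the walk\<close>

text \<open>The odd part of the exponential series is sinh, and exp(-\<mu>) sinh(\<mu>) = (1 -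
  exp(-2\<mu>)) / 2.\<close>

lemma poisson_pmf_odd:
  assumes \<mu>: "\<mu> > 0"
  shows "measure_pmf.prob (poisson_pmf \<mu>) {n. odd n} = (1 - exp (- 2 * \<mu>)) / 2"
proof -
  \<comment> \<open>Even indices get the empty set, so that the series has the same zero terms as
    that of sinh.\<close>
  define A where "A n = (if even n then {} else {n})" for n :: nat
  have "(\<lambda>n. measure_pmf.prob (poisson_pmf \<mu>) (A n)) sums measure_pmf.prob (poisson_pmf \<mu>) (\<Union>n. A n)"
    by (rule measure_pmf.finite_measure_UNION) (auto simp: A_def disjoint_family_on_def)
  moreover have "(\<Union>n. A n) = {n. odd n}"
    by (auto simp: A_def split: if_splits)
  moreover have "measure_pmf.prob (poisson_pmf \<mu>) (A n) = exp (- \<mu>) * (if even n then 0 else \<mu> ^ n /\<^sub>R fact n)" for n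
    using \<mu> by (simp add: A_def measure_pmf_single divide_inverse)
  ultimately have "(\<lambda>n. exp (- \<mu>) * (if even n then 0 else \<mu> ^ n /\<^sub>R fact n)) sums
      measure_pmf.prob (poisson_pmf \<mu>) {n. odd n}" by simp
  moreover have "(\<lambda>n. exp (- \<mu>) * (if even n then 0 else \<mu> ^ n /\<^sub>R fact n)) sums (exp (- \<mu>) * sinh \<mu>)"
    by (intro sums_mult sinh_converges)
  ultimately have "measure_pmf.prob (poisson_pmf \<mu>) {n. odd n} = exp (- \<mu>) * sinh \<mu>"
    by (rule sums_unique2)
  also have "\<dots> = (1 - exp (- 2 * \<mu>)) / 2"
    by (simp add: sinh_field_def algebra_simps exp_add[symmetric] diff_divide_distrib)
  finally show ?thesis .
qed

section \<open>Law of the sampled flips\<close>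

definition flip_path :: "(real \<Rightarrow> 'a \<Rightarrow> nat) \<Rightarrow> real \<Rightarrow> nat \<Rightarrow> 'a \<Rightarrow> bool list" where
  "flip_path N \<delta> K \<omega> = map (\<lambda>i. odd (N (real (Suc i) * \<delta>) \<omega> - N (real i * \<delta>) \<omega>)) [0..<K]"

lemma length_flip_path [simp]: "length (flip_path N \<delta> K \<omega>) = K"
  by (simp add: flip_path_def)

lemma flip_path_Suc:
  "flip_path N \<delta> (Suc K) \<omega> =
     flip_path N \<delta> K \<omega> @ [odd (N (real (Suc K) * \<delta>) \<omega> - N (real K * \<delta>) \<omega>)]"
  by (simp add: flip_path_def)

lemma take_flip_path: "k \<le> K \<Longrightarrow> take k (flip_path N \<delta> K \<omega>) = flip_path N \<delta> k \<omega>"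
  by (simp add: flip_path_def take_map)

lemma flip_path_eq_iff:
  "length bs = K \<Longrightarrow> flip_path N \<delta> K \<omega> = bs \<longleftrightarrow>
     (\<forall>i<K. odd (N (real (Suc i) * \<delta>) \<omega> - N (real i * \<delta>) \<omega>) = bs ! i)"
  by (auto simp: flip_path_def list_eq_iff_nth_eq)

lemma walk_max_measurable [measurable]: "(\<lambda>v. walk_max v bs) \<in> borel_measurable borel"
proof (induction bs)
  case (Cons b bs)
  then have [measurable]: "(\<lambda>v. walk_max v bs) \<in> borel_measurable borel" .
  have "(\<lambda>v. walk_max (- v) bs) \<in> borel_measurable borel"
    by (rule measurable_compose[OF _ Cons]) simp
  with Cons show ?case by (cases b) (auto simp: Let_def intro!: borel_measurable_max borel_measurable_add)
qed simp

context symmetric_telegraph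
begin

lemma increment_measurable:
  assumes "0 \<le> s" "0 \<le> u"
  shows "(\<lambda>\<omega>. N u \<omega> - N s \<omega>) \<in> measurable M (count_space UNIV)"
proof (rule measurable_compose_countable[OF _ N_measurable[OF assms(1)],
    where f = "\<lambda>i \<omega>. N u \<omega> - i"])
  show "(\<lambda>\<omega>. N u \<omega> - i) \<in> measurable M (count_space UNIV)" for i
    by (rule measurable_compose[OF N_measurable[OF assms(2)], where g = "\<lambda>n. n - i"]) simp
qed

lemma flip_path_measurable:
  assumes "\<delta> \<ge> 0"
  shows "flip_path N \<delta> K \<in> measurable M (count_space UNIV)"
proof (induction K)
  case 0
  have "flip_path N \<delta> 0 = (\<lambda>_. [])" by (simp add: flip_path_def[abs_def])
  then show ?case by simp
next
  case (Suc K)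
  let ?D = "\<lambda>\<omega>. N (real (Suc K) * \<delta>) \<omega> - N (real K * \<delta>) \<omega>"
  have D: "?D \<in> measurable M (count_space UNIV)"
    by (rule increment_measurable) (use assms in auto)
  have "(\<lambda>\<omega>. flip_path N \<delta> K \<omega> @ [odd (?D \<omega>)]) \<in> measurable M (count_space UNIV)"
  proof (rule measurable_compose_countable[OF _ Suc.IH, where f = "\<lambda>bs \<omega>. bs @ [odd (?D \<omega>)]"])
    show "(\<lambda>\<omega>. bs @ [odd (?D \<omega>)]) \<in> measurable M (count_space UNIV)" for bs
      by (rule measurable_compose[OF D, where g = "\<lambda>d. bs @ [odd d]"]) simp
  qed
  then show ?case unfolding flip_path_Suc .
qed

text \<open>\<open>V0_indep_N\<close> speaks of the process as one element of a product space, so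
  the event must be exhibited as the preimage of a measurable set \<open>S\<close> that constrains
  finitely many coordinates. Independent increments then factor the parities; \<open>K > 0\<close>
  keeps the index set nonempty, as \<open>indep_varsD\<close> and the intersection require.\<close>

lemma flip_path_prob:
  assumes \<delta>: "\<delta> > 0" and len: "length bs = K" and K: "K > 0"
  shows "prob {\<omega> \<in> space M. V0 \<omega> = c \<and> flip_path N \<delta> K \<omega> = bs} =
    1 / 2 * (\<Prod>b\<leftarrow>bs. if b then (1 - exp (- 2 * (rate * \<delta>))) / 2 else 1 - (1 - exp (- 2 * (rate * \<delta>))) / 2)"
proof -
  let ?p = "(1 - exp (- 2 * (rate * \<delta>))) / 2"
  let ?D = "\<lambda>i \<omega>. N (real (Suc i) * \<delta>) \<omega> - N (real i * \<delta>) \<omega>"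
  let ?P = "PiM {0::real..} (\<lambda>_. count_space (UNIV :: nat set))"
  let ?X = "\<lambda>\<omega>. \<lambda>t\<in>{0::real..}. N t \<omega>"
  have "{\<omega> \<in> space M. V0 \<omega> = c} = V0 -` {c} \<inter> space M" by auto
  then have A: "{\<omega> \<in> space M. V0 \<omega> = c} \<in> sets (vimage_algebra (space M) V0 borel)"
    by (simp add: in_vimage_algebra)
  define S where "S = {f \<in> space ?P. \<forall>i\<in>{..<K}. odd (f (real (Suc i) * \<delta>) - f (real i * \<delta>)) = bs ! i}"
  have "S \<in> sets ?P"
    unfolding S_def
  proof (rule sets.sets_Collect_finite_All)
    fix i
    have m: "(\<lambda>f. f s) \<in> measurable ?P (count_space UNIV)" if "s \<ge> 0" for s
      using that by (intro measurable_component_singleton) auto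
    have "(\<lambda>f. f (real (Suc i) * \<delta>) - f (real i * \<delta>)) \<in> measurable ?P (count_space UNIV)"
    proof (rule measurable_compose_countable[where g = "\<lambda>f. f (real i * \<delta>)"
        and f = "\<lambda>n f. f (real (Suc i) * \<delta>) - n"])
      show "(\<lambda>f. f (real (Suc i) * \<delta>) - n) \<in> measurable ?P (count_space UNIV)" for n
        by (rule measurable_compose[OF m]) (use \<delta> in auto)
    qed (rule m, use \<delta> in auto)
    then have "(\<lambda>f. odd (f (real (Suc i) * \<delta>) - f (real i * \<delta>)) = bs ! i) \<in> measurable ?P (count_space UNIV)"
      by (rule measurable_compose) simp
    then show "{f \<in> space ?P. odd (f (real (Suc i) * \<delta>) - f (real i * \<delta>)) = bs ! i} \<in> sets ?P"
      by (simp add: pred_def)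
  qed auto
  then have "?X -` S \<inter> space M \<in> sets (vimage_algebra (space M) ?X ?P)"
    by (rule in_vimage_algebra)
  moreover have "?X -` S \<inter> space M = {\<omega> \<in> space M. flip_path N \<delta> K \<omega> = bs}"
    using \<delta> by (auto simp: S_def flip_path_eq_iff[OF len] space_PiM)
  ultimately have B: "{\<omega> \<in> space M. flip_path N \<delta> K \<omega> = bs} \<in> sets (vimage_algebra (space M) ?X ?P)"
    by simp
  have "{\<omega> \<in> space M. V0 \<omega> = c \<and> flip_path N \<delta> K \<omega> = bs} =
      {\<omega> \<in> space M. V0 \<omega> = c} \<inter> {\<omega> \<in> space M. flip_path N \<delta> K \<omega> = bs}" by auto
  then have 1: "prob {\<omega> \<in> space M. V0 \<omega> = c \<and> flip_path N \<delta> K \<omega> = bs} =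
      1 / 2 * prob {\<omega> \<in> space M. flip_path N \<delta> K \<omega> = bs}"
    using indep_setD[OF V0_indep_N A B] V0_pos by simp
  have odd: "prob (?D i -` {n. odd n = b} \<inter> space M) = (if b then ?p else 1 - ?p)" for i b
  proof -
    have m: "?D i \<in> measurable M (count_space UNIV)"
      by (rule increment_measurable) (use \<delta> in auto)
    have "distr M (count_space UNIV) (?D i) = measure_pmf (poisson_pmf (rate * (real (Suc i) * \<delta> - real i * \<delta>)))"
      by (rule N_increment_distr) (use \<delta> in auto)
    then have d: "distr M (count_space UNIV) (?D i) = measure_pmf (poisson_pmf (rate * \<delta>))"
      by (simp add: algebra_simps)
    have "prob (?D i -` {n. odd n = b} \<inter> space M) = measure (distr M (count_space UNIV) (?D i)) {n. odd n = b}"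
      by (rule measure_distr[symmetric, OF m]) auto
    also have "\<dots> = measure_pmf.prob (poisson_pmf (rate * \<delta>)) {n. odd n = b}"
      by (simp only: d)
    also have "\<dots> = (if b then ?p else 1 - ?p)"
    proof -
      have o: "measure_pmf.prob (poisson_pmf (rate * \<delta>)) {n. odd n} = ?p"
        by (rule poisson_pmf_odd) (use \<delta> rate_pos in auto)
      have "{n. even n} = UNIV - {n :: nat. odd n}" by auto
      then have "measure_pmf.prob (poisson_pmf (rate * \<delta>)) {n. even n} = 1 - ?p"
        using o measure_pmf.prob_compl[of "{n. odd n}" "poisson_pmf (rate * \<delta>)"] by simp
      with o show ?thesis by (cases b) auto
    qed
    finally show ?thesis .
  qed
  have "indep_vars (\<lambda>_. count_space UNIV) ?D {..<K}"
    using N_indep_increments[of "\<lambda>i. real i * \<delta>" K] \<delta> by simp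
  then have "prob (\<Inter>i\<in>{..<K}. ?D i -` {n. odd n = bs ! i} \<inter> space M) =
      (\<Prod>i\<in>{..<K}. prob (?D i -` {n. odd n = bs ! i} \<inter> space M))"
    by (rule indep_varsD) (use K in auto)
  also have "(\<Inter>i\<in>{..<K}. ?D i -` {n. odd n = bs ! i} \<inter> space M) = {\<omega> \<in> space M. flip_path N \<delta> K \<omega> = bs}"
    using K by (auto simp: flip_path_eq_iff[OF len])
  also have "(\<Prod>i\<in>{..<K}. prob (?D i -` {n. odd n = bs ! i} \<inter> space M)) = (\<Prod>b\<leftarrow>bs. if b then ?p else 1 - ?p)"
    unfolding odd by (simp add: prod.list_conv_set_nth len atLeast0LessThan)
  finally show ?thesis using 1 by simp
qed

lemma expectation_flip_path:
  assumes \<delta>: "\<delta> > 0" and K: "K > 0"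
  shows "expectation (\<lambda>\<omega>. indicator {\<omega> \<in> space M. V0 \<omega> = c} \<omega> * F (flip_path N \<delta> K \<omega>)) =
    1 / 2 * flip_exp ((1 - exp (- 2 * (rate * \<delta>))) / 2) K F"
proof -
  let ?E = "\<lambda>bs. {\<omega> \<in> space M. V0 \<omega> = c \<and> flip_path N \<delta> K \<omega> = bs}"
  have fin: "finite {bs :: bool list. length bs = K}"
    using finite_lists_length_eq[of "UNIV :: bool set" K] by simp
  have meas: "?E bs \<in> events" for bs
  proof -
    have "V0 -` {c} \<inter> space M \<in> events" "flip_path N \<delta> K -` {bs} \<inter> space M \<in> events"
      using measurable_sets[OF V0_measurable] measurable_sets[OF flip_path_measurable[of \<delta> K]] \<delta> by auto
    moreover have "?E bs = (V0 -` {c} \<inter> space M) \<inter> (flip_path N \<delta> K -` {bs} \<inter> space M)" by auto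
    ultimately show ?thesis by auto
  qed
  have "expectation (\<lambda>\<omega>. indicator {\<omega> \<in> space M. V0 \<omega> = c} \<omega> * F (flip_path N \<delta> K \<omega>)) =
      expectation (\<lambda>\<omega>. \<Sum>bs | length bs = K. F bs * indicator (?E bs) \<omega>)"
  proof (rule Bochner_Integration.integral_cong[OF refl])
    fix \<omega> assume w: "\<omega> \<in> space M"
    have "(\<Sum>bs | length bs = K. F bs * indicator (?E bs) \<omega>) =
        (\<Sum>bs | length bs = K. if bs = flip_path N \<delta> K \<omega> then F bs * of_bool (V0 \<omega> = c) else 0)"
      using w by (intro sum.cong) (auto simp: indicator_def)
    also have "\<dots> = F (flip_path N \<delta> K \<omega>) * of_bool (V0 \<omega> = c)"
      using fin by (subst sum.delta) auto
    finally show "indicator {\<omega> \<in> space M. V0 \<omega> = c} \<omega> * F (flip_path N \<delta> K \<omega>) =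
        (\<Sum>bs | length bs = K. F bs * indicator (?E bs) \<omega>)"
      using w by (simp add: indicator_def)
  qed
  also have "\<dots> = (\<Sum>bs | length bs = K. F bs * prob (?E bs))"
    using meas by (subst Bochner_Integration.integral_sum) (auto intro!: sum.cong simp: emeasure_eq_measure)
  also have "\<dots> = (\<Sum>bs | length bs = K. 1 / 2 * ((\<Prod>b\<leftarrow>bs. if b then (1 - exp (- 2 * (rate * \<delta>))) / 2
      else 1 - (1 - exp (- 2 * (rate * \<delta>))) / 2) * F bs))"
    by (intro sum.cong refl, subst flip_path_prob[OF \<delta> _ K]) simp_all
  also have "\<dots> = 1 / 2 * flip_exp ((1 - exp (- 2 * (rate * \<delta>))) / 2) K F"
    by (simp only: flip_exp_eq_sum sum_distrib_left)
  finally show ?thesis .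
qed

section \<open>Pathwise convergence of the maximum\<close>

lemma telegraph_eq_integral:
  assumes w: "\<omega> \<in> space M"
  shows "telegraph V0 N s \<omega> = integral {0..s} (\<lambda>s. V0 \<omega> * (-1) ^ N s \<omega>)"
    and "(\<lambda>s. V0 \<omega> * (-1) ^ N s \<omega>) integrable_on {0..s}"
  using set_borel_integral_eq_integral[OF telegraph_integrand_integrable[OF w]]
  by (auto simp: telegraph_def)

lemma telegraph_increment:
  assumes w: "\<omega> \<in> space M" and ab: "0 \<le> a" "a \<le> b"
  shows "((\<lambda>s. V0 \<omega> * (-1) ^ N s \<omega>) has_integral telegraph V0 N b \<omega> - telegraph V0 N a \<omega>) {a..b}"
proof -
  note int = telegraph_eq_integral(2)[OF w, of b]
  have "(\<lambda>s. V0 \<omega> * (-1) ^ N s \<omega>) integrable_on {a..b}"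
    by (rule integrable_on_subinterval[OF int]) (use ab in auto)
  moreover have "integral {a..b} (\<lambda>s. V0 \<omega> * (-1) ^ N s \<omega>) = telegraph V0 N b \<omega> - telegraph V0 N a \<omega>"
    using Henstock_Kurzweil_Integration.integral_combine[OF ab int] by (simp add: telegraph_eq_integral(1)[OF w])
  ultimately show ?thesis by (metis integrable_integral)
qed

lemma telegraph_lipschitz:
  assumes w: "\<omega> \<in> space M" and ab: "0 \<le> a" "a \<le> b"
  shows "\<bar>telegraph V0 N b \<omega> - telegraph V0 N a \<omega>\<bar> \<le> \<bar>V0 \<omega>\<bar> * (b - a)"
  using has_integral_bound[OF _ telegraph_increment[OF w ab, unfolded interval_cbox], of "\<bar>V0 \<omega>\<bar>"] ab
  by (simp add: abs_mult power_abs)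

text \<open>Exactly the odd increments change the sign, so at grid times the velocity of the walk
  carries no error.\<close>

lemma walk_vel_flip_path:
  assumes w: "\<omega> \<in> space M" and \<delta>: "\<delta> \<ge> 0"
  shows "walk_vel v (flip_path N \<delta> k \<omega>) = v * (-1) ^ N (real k * \<delta>) \<omega>"
proof (induction k)
  case 0
  then show ?case using N_zero[OF w] by (simp add: flip_path_def)
next
  case (Suc k)
  have "N (real k * \<delta>) \<omega> \<le> N (real (Suc k) * \<delta>) \<omega>"
    by (rule N_mono[OF w]) (use \<delta> in \<open>auto intro: mult_right_mono\<close>)
  then obtain d where d: "N (real (Suc k) * \<delta>) \<omega> = N (real k * \<delta>) \<omega> + d"
    using le_Suc_ex by blast
  show ?case
    unfolding flip_path_Suc walk_vel_snoc d Suc.IH by (simp add: power_add)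
qed

text \<open>A grid interval without switches adds no error; any other adds at most 2 \<bar>V0\<bar>
  \<delta>, hence at most that times the number of switches in it. The counts telescope, so the
  error is governed by the number of switches and not by the number of intervals.\<close>

lemma telegraph_flip_path:
  assumes w: "\<omega> \<in> space M" and \<delta>: "\<delta> > 0"
  shows "\<bar>telegraph V0 N (real k * \<delta>) \<omega> - \<delta> * walk (V0 \<omega>) (flip_path N \<delta> k \<omega>)\<bar>
    \<le> 2 * \<bar>V0 \<omega>\<bar> * \<delta> * real (N (real k * \<delta>) \<omega>)"
proof (induction k)
  case 0
  then show ?case using N_zero[OF w] by (simp add: telegraph_eq_integral(1)[OF w] flip_path_def)
next
  case (Suc k)
  define a b where "a = real k * \<delta>" and "b = real (Suc k) * \<delta>"
  have ab: "0 \<le> a" "a \<le> b" "b - a = \<delta>"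
    using \<delta> by (auto simp: a_def b_def algebra_simps)
  have mono: "N a \<omega> \<le> N b \<omega>" by (rule N_mono[OF w]) (use ab in auto)
  \<comment> \<open>The comparison velocity is that at the right end \<open>b\<close>, since a flip
    acts before its step is made.\<close>
  have hi: "((\<lambda>s. V0 \<omega> * (-1) ^ N s \<omega> - V0 \<omega> * (-1) ^ N b \<omega>) has_integral
      (telegraph V0 N b \<omega> - telegraph V0 N a \<omega>) - \<delta> * (V0 \<omega> * (-1) ^ N b \<omega>)) {a..b}"
    using has_integral_diff[OF telegraph_increment[OF w ab(1,2)] has_integral_const_real[of "V0 \<omega> * (-1) ^ N b \<omega>" a b]]
      ab by simp
  have "norm (telegraph V0 N b \<omega> - telegraph V0 N a \<omega> - \<delta> * (V0 \<omega> * (-1) ^ N b \<omega>))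
      \<le> (2 * \<bar>V0 \<omega>\<bar> * (real (N b \<omega>) - real (N a \<omega>))) * measure lborel (cbox a b)"
  proof (rule has_integral_bound[OF _ hi[unfolded interval_cbox]])
    fix s assume "s \<in> cbox a b"
    then have "N a \<omega> \<le> N s \<omega>" "N s \<omega> \<le> N b \<omega>"
      using ab by (auto intro!: N_mono[OF w])
    then consider "N s \<omega> = N b \<omega>" | "real (N b \<omega>) - real (N a \<omega>) \<ge> 1" by linarith
    then show "norm (V0 \<omega> * (-1) ^ N s \<omega> - V0 \<omega> * (-1) ^ N b \<omega>) \<le> 2 * \<bar>V0 \<omega>\<bar> * (real (N b \<omega>) - real (N a \<omega>))"
    proof cases
      case 1
      then show ?thesis using mono by simp
    next
      case 2
      have "norm (V0 \<omega> * (-1) ^ N s \<omega> - V0 \<omega> * (-1) ^ N b \<omega>) \<le> \<bar>V0 \<omega>\<bar> + \<bar>V0 \<omega>\<bar>"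
        by (rule order_trans[OF norm_triangle_ineq4]) (simp add: abs_mult power_abs)
      also have "\<dots> \<le> 2 * \<bar>V0 \<omega>\<bar> * (real (N b \<omega>) - real (N a \<omega>))"
        using mult_left_mono[OF 2, of "2 * \<bar>V0 \<omega>\<bar>"] by simp
      finally show ?thesis .
    qed
  qed (use mono in auto)
  also have "\<dots> = 2 * \<bar>V0 \<omega>\<bar> * \<delta> * (real (N b \<omega>) - real (N a \<omega>))"
    using ab by simp
  finally have 1: "\<bar>telegraph V0 N b \<omega> - telegraph V0 N a \<omega> - \<delta> * (V0 \<omega> * (-1) ^ N b \<omega>)\<bar>
      \<le> 2 * \<bar>V0 \<omega>\<bar> * \<delta> * real (N b \<omega>) - 2 * \<bar>V0 \<omega>\<bar> * \<delta> * real (N a \<omega>)"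
    by (simp add: right_diff_distrib)
  have 2: "walk (V0 \<omega>) (flip_path N \<delta> (Suc k) \<omega>) = walk (V0 \<omega>) (flip_path N \<delta> k \<omega>) + V0 \<omega> * (-1) ^ N b \<omega>"
    using walk_vel_flip_path[OF w, of \<delta> "V0 \<omega>" "Suc k"] \<delta>
    unfolding flip_path_Suc b_def by (simp del: walk_vel_snoc)
  show ?case
    using Suc.IH 1 unfolding 2 distrib_left a_def[symmetric] b_def[symmetric] by linarith
qed

text \<open>The maximising time is rounded down to the grid, at cost \<bar>V0\<bar> \<delta> by the
  speed bound. Conversely the walk maximum is taken at a grid time, where the process lies below its
  own maximum.\<close>

lemma telegraph_max_flip_path:
  assumes w: "\<omega> \<in> space M" and t: "t > 0" and K: "K > 0"
  shows "\<bar>t / real K * walk_max (V0 \<omega>) (flip_path N (t / real K) K \<omega>) - telegraph_max V0 N t \<omega>\<bar>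
    \<le> \<bar>V0 \<omega>\<bar> * (t / real K) * (2 * real (N t \<omega>) + 1)"
proof -
  define \<delta> where "\<delta> = t / real K"
  have \<delta>: "\<delta> > 0" "real K * \<delta> = t" using t K by (auto simp: \<delta>_def)
  let ?bs = "flip_path N \<delta> K \<omega>"
  have kt: "real k * \<delta> \<le> t" if "k \<le> K" for k
    using that \<delta> mult_right_mono[of "real k" "real K" \<delta>] by simp
  have err: "\<bar>telegraph V0 N (real k * \<delta>) \<omega> - \<delta> * walk (V0 \<omega>) (take k ?bs)\<bar> \<le> 2 * \<bar>V0 \<omega>\<bar> * \<delta> * real (N t \<omega>)"
    if k: "k \<le> K" for k
  proof -
    have "N (real k * \<delta>) \<omega> \<le> N t \<omega>"
      by (rule N_mono[OF w]) (use kt[OF k] \<delta> in auto)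
    then have "2 * \<bar>V0 \<omega>\<bar> * \<delta> * real (N (real k * \<delta>) \<omega>) \<le> 2 * \<bar>V0 \<omega>\<bar> * \<delta> * real (N t \<omega>)"
      using \<delta> by (intro mult_left_mono) auto
    then show ?thesis
      unfolding take_flip_path[OF k] by (rule order_trans[OF telegraph_flip_path[OF w \<delta>(1)]])
  qed
  obtain s where s: "s \<in> {0..t}" "telegraph_max V0 N t \<omega> = telegraph V0 N s \<omega>"
    "\<And>r. r \<in> {0..t} \<Longrightarrow> telegraph V0 N r \<omega> \<le> telegraph V0 N s \<omega>"
    using telegraph_max_attained[OF w, of t] t by (metis less_imp_le)
  have "telegraph V0 N s \<omega> - \<delta> * walk_max (V0 \<omega>) ?bs \<le> \<bar>V0 \<omega>\<bar> * \<delta> + 2 * \<bar>V0 \<omega>\<bar> * \<delta> * real (N t \<omega>)"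
  proof -
    define k where "k = nat \<lfloor>s / \<delta>\<rfloor>"
    have "real k \<le> s / \<delta>" "s / \<delta> < real k + 1"
      using s(1) \<delta>(1) unfolding k_def by (auto simp: of_nat_nat)
    then have k: "real k * \<delta> \<le> s" "s - real k * \<delta> \<le> \<delta>"
      using \<delta>(1) by (auto simp: field_simps)
    have "real k * \<delta> \<le> real K * \<delta>" using k s \<delta>(2) by simp
    then have kK: "k \<le> K" using \<delta>(1) by simp
    have "\<bar>telegraph V0 N s \<omega> - telegraph V0 N (real k * \<delta>) \<omega>\<bar> \<le> \<bar>V0 \<omega>\<bar> * (s - real k * \<delta>)"
      by (rule telegraph_lipschitz[OF w]) (use k \<delta> in auto)
    also have "\<dots> \<le> \<bar>V0 \<omega>\<bar> * \<delta>" using k by (intro mult_left_mono) auto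
    finally have "\<bar>telegraph V0 N s \<omega> - telegraph V0 N (real k * \<delta>) \<omega>\<bar> \<le> \<bar>V0 \<omega>\<bar> * \<delta>" .
    moreover have "\<delta> * walk (V0 \<omega>) (take k ?bs) \<le> \<delta> * walk_max (V0 \<omega>) ?bs"
      using \<delta>(1) walk_take_le_max by (intro mult_left_mono) auto
    ultimately show ?thesis using err[OF kK] by linarith
  qed
  moreover have "\<delta> * walk_max (V0 \<omega>) ?bs - telegraph V0 N s \<omega> \<le> 2 * \<bar>V0 \<omega>\<bar> * \<delta> * real (N t \<omega>)"
  proof -
    obtain k where k: "k \<le> K" "walk_max (V0 \<omega>) ?bs = walk (V0 \<omega>) (take k ?bs)"
      using walk_max_attained[of ?bs "V0 \<omega>"] by auto
    have "telegraph V0 N (real k * \<delta>) \<omega> \<le> telegraph V0 N s \<omega>"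
      by (rule s(3)) (use kt[OF k(1)] \<delta> in auto)
    then show ?thesis using err[OF k(1)] k(2) by simp
  qed
  moreover have "\<bar>V0 \<omega>\<bar> * \<delta> \<ge> 0" using \<delta> by simp
  ultimately have "\<bar>\<delta> * walk_max (V0 \<omega>) ?bs - telegraph_max V0 N t \<omega>\<bar> \<le> \<bar>V0 \<omega>\<bar> * \<delta> + 2 * \<bar>V0 \<omega>\<bar> * \<delta> * real (N t \<omega>)"
    unfolding s(2) by linarith
  then show ?thesis by (simp add: \<delta>_def[symmetric] algebra_simps)
qed

lemma telegraph_max_limit:
  assumes w: "\<omega> \<in> space M" and t: "t > 0"
  shows "(\<lambda>K. t / real K * walk_max (V0 \<omega>) (flip_path N (t / real K) K \<omega>)) \<longlonglongrightarrow> telegraph_max V0 N t \<omega>"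
proof -
  have "(\<lambda>K. t / real K * walk_max (V0 \<omega>) (flip_path N (t / real K) K \<omega>) - telegraph_max V0 N t \<omega>) \<longlonglongrightarrow> 0"
  proof (rule Lim_null_comparison)
    show "\<forall>\<^sub>F K in sequentially. norm (t / real K * walk_max (V0 \<omega>) (flip_path N (t / real K) K \<omega>) - telegraph_max V0 N t \<omega>)
        \<le> \<bar>V0 \<omega>\<bar> * (t / real K) * (2 * real (N t \<omega>) + 1)"
      using eventually_gt_at_top[of 0]
      by eventually_elim (use telegraph_max_flip_path[OF w t] in auto)
    show "(\<lambda>K. \<bar>V0 \<omega>\<bar> * (t / real K) * (2 * real (N t \<omega>) + 1)) \<longlonglongrightarrow> 0"
      using tendsto_mult_right_zero[OF lim_1_over_n, of "\<bar>V0 \<omega>\<bar> * t * (2 * real (N t \<omega>) + 1)"]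
      by (simp add: mult_ac)
  qed
  then show ?thesis by (simp add: LIM_zero_iff)
qed

lemma walk_max_flip_path_measurable:
  assumes "\<delta> \<ge> 0"
  shows "(\<lambda>\<omega>. walk_max (V0 \<omega>) (flip_path N \<delta> K \<omega>)) \<in> borel_measurable M"
proof (rule measurable_compose_countable[OF _ flip_path_measurable[OF assms]])
  show "(\<lambda>\<omega>. walk_max (V0 \<omega>) bs) \<in> borel_measurable M" for bs
    by (rule measurable_compose[OF V0_measurable walk_max_measurable])
qed

text \<open>A sequential limit of measurable walk maxima replaces the supremum over uncountably many
  times.\<close>

lemma telegraph_max_measurable:
  assumes "t > 0"
  shows "telegraph_max V0 N t \<in> borel_measurable M"
proof (rule borel_measurable_LIMSEQ_real[OF telegraph_max_limit])
  show "(\<lambda>\<omega>. t / real K * walk_max (V0 \<omega>) (flip_path N (t / real K) K \<omega>)) \<in> borel_measurable M" for K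
    by (intro borel_measurable_times borel_measurable_const walk_max_flip_path_measurable)
       (use assms in auto)
qed (use assms in auto)

section \<open>Conditioning and passage to the limit\<close>

lemma initial_velocity_event: "{\<omega> \<in> space M. V0 \<omega> = c} \<in> events"
proof -
  have "{\<omega> \<in> space M. V0 \<omega> = c} = V0 -` {c} \<inter> space M" by auto
  then show ?thesis using measurable_sets[OF V0_measurable, of "{c}"] by simp
qed

text \<open>The event has probability 1/2, so the normalising factor is 2; it later cancels the 1/2
  in \<open>expectation_flip_path\<close>.\<close>

lemma cond_expectation_initial_velocity:
  assumes f: "f \<in> borel_measurable M"
  shows "cond_expectation M f {\<omega> \<in> space M. V0 \<omega> = c} =
    2 * expectation (\<lambda>\<omega>. indicator {\<omega> \<in> space M. V0 \<omega> = c} \<omega> * f \<omega>)"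
proof -
  let ?A = "{\<omega> \<in> space M. V0 \<omega> = c}"
  note A = initial_velocity_event
  have "uniform_measure M ?A = density M (\<lambda>\<omega>. ennreal (2 * indicator ?A \<omega>))"
    unfolding uniform_measure_def
  proof (rule density_cong)
    have "indicator ?A \<omega> / emeasure M ?A = ennreal (2 * indicator ?A \<omega>)" for \<omega>
    proof -
      have e: "emeasure M ?A = ennreal (1 / 2)"
        by (simp only: emeasure_eq_measure V0_pos)
      have "(1 :: ennreal) / ennreal (1 / 2) = ennreal 2"
        using divide_ennreal[of 1 "1 / 2"] by simp
      then show ?thesis
        unfolding e by (cases "\<omega> \<in> ?A") (simp_all only: indicator_simps, simp_all)
    qed
    then show "AE \<omega> in M. indicator ?A \<omega> / emeasure M ?A = ennreal (2 * indicator ?A \<omega>)" by simp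
  qed (use A in auto)
  then have "cond_expectation M f ?A = expectation (\<lambda>\<omega>. (2 * indicator ?A \<omega>) *\<^sub>R f \<omega>)"
    unfolding cond_expectation_def using f A by (simp only:) (subst integral_density, auto)
  also have "\<dots> = 2 * expectation (\<lambda>\<omega>. indicator ?A \<omega> * f \<omega>)"
    by (simp add: mult.assoc)
  finally show ?thesis .
qed

text \<open>One sequence of expectations has two limits: by dominated convergence along paths, and
  by the law of the flips after the speed \<open>c\<close> is factored out.\<close>

lemma telegraph_max_moment:
  assumes t: "t > 0" and m: "m \<ge> 1"
  shows "cond_expectation M (\<lambda>\<omega>. telegraph_max V0 N t \<omega> ^ m) {\<omega> \<in> space M. V0 \<omega> = c} =
    (c * t) ^ m * poisson_mean (rate * t) (\<lambda>n. beta_moment n (real m / 2))"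
proof -
  let ?A = "{\<omega> \<in> space M. V0 \<omega> = c}"
  let ?W = "\<lambda>K \<omega>. t / real K * walk_max (V0 \<omega>) (flip_path N (t / real K) K \<omega>)"
  note initial_velocity_event [measurable]
  have [measurable]: "telegraph_max V0 N t \<in> borel_measurable M" by (rule telegraph_max_measurable[OF t])
  have [measurable]: "(\<lambda>\<omega>. walk_max (V0 \<omega>) (flip_path N (t / real K) K \<omega>)) \<in> borel_measurable M" for K
    by (rule walk_max_flip_path_measurable) (use t in auto)
  have "(\<lambda>K. expectation (\<lambda>\<omega>. indicator ?A \<omega> * ?W K \<omega> ^ m)) \<longlonglongrightarrow>
      expectation (\<lambda>\<omega>. indicator ?A \<omega> * telegraph_max V0 N t \<omega> ^ m)"
  \<comment> \<open>On the event the walk makes \<open>K\<close> steps of length c t / K, so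
    \<open>(c * t) ^ m\<close> dominates; off the event the integrand is 0, whatever value
    \<open>V0\<close> takes.\<close>
  proof (rule integral_dominated_convergence[where w = "\<lambda>_. (c * t) ^ m"])
    show "AE \<omega> in M. (\<lambda>K. indicator ?A \<omega> * ?W K \<omega> ^ m) \<longlonglongrightarrow> indicator ?A \<omega> * telegraph_max V0 N t \<omega> ^ m"
      by (rule AE_I2) (intro tendsto_mult tendsto_power tendsto_const telegraph_max_limit t)
    show "AE \<omega> in M. norm (indicator ?A \<omega> * ?W K \<omega> ^ m) \<le> (c * t) ^ m" for K
    proof (rule AE_I2)
      fix \<omega> assume "\<omega> \<in> space M"
      show "norm (indicator ?A \<omega> * ?W K \<omega> ^ m) \<le> (c * t) ^ m"
      proof (cases "V0 \<omega> = c")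
        case True
        have "\<bar>?W K \<omega>\<bar> \<le> c * t"
        proof (cases "K = 0")
          case False
          have "\<bar>?W K \<omega>\<bar> = t / real K * walk_max c (flip_path N (t / real K) K \<omega>)"
            using t walk_max_nonneg True by (simp add: abs_mult)
          also have "\<dots> \<le> t / real K * (c * real K)"
            using walk_max_le[of c "flip_path N (t / real K) K \<omega>"] t speed_pos
            by (intro mult_left_mono) auto
          finally show ?thesis using False by (simp add: mult.commute)
        \<comment> \<open>For \<open>K = 0\<close> the scaling \<open>t / real K\<close> is
          0.\<close>
        qed (use t speed_pos in auto)
        then have "norm (indicator ?A \<omega> * ?W K \<omega> ^ m) \<le> 1 * (c * t) ^ m"
          unfolding norm_mult norm_power using t speed_pos
          by (intro mult_mono[OF _ power_mono]) (auto simp: indicator_def abs_mult)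
        then show ?thesis by simp
      qed (use t speed_pos in auto)
    qed
  qed auto
  moreover have "\<forall>\<^sub>F K in sequentially. expectation (\<lambda>\<omega>. indicator ?A \<omega> * ?W K \<omega> ^ m) =
      1 / 2 * ((c * t) ^ m * flip_exp ((1 - exp (- 2 * (rate * t / real K))) / 2) K (\<lambda>bs. (walk_max 1 bs / real K) ^ m))"
    using eventually_gt_at_top[of 0]
  proof eventually_elim
    case (elim K)
    have "expectation (\<lambda>\<omega>. indicator ?A \<omega> * ?W K \<omega> ^ m) =
        expectation (\<lambda>\<omega>. indicator ?A \<omega> * ((c * t) ^ m * (walk_max 1 (flip_path N (t / real K) K \<omega>) / real K) ^ m))"
    proof (rule Bochner_Integration.integral_cong[OF refl])
      fix \<omega>
      have "walk_max c bs = c * walk_max 1 bs" for bs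
        using walk_max_scale[of c 1 bs] speed_pos by simp
      then show "indicator ?A \<omega> * ?W K \<omega> ^ m =
          indicator ?A \<omega> * ((c * t) ^ m * (walk_max 1 (flip_path N (t / real K) K \<omega>) / real K) ^ m)"
        by (simp add: indicator_def power_mult_distrib[symmetric] mult_ac)
    qed
    also have "\<dots> = 1 / 2 * flip_exp ((1 - exp (- 2 * (rate * (t / real K)))) / 2) K
        (\<lambda>bs. (c * t) ^ m * (walk_max 1 bs / real K) ^ m)"
      using expectation_flip_path[of "t / real K" K "\<lambda>bs. (c * t) ^ m * (walk_max 1 bs / real K) ^ m"] t elim
      by simp
    finally show ?case by (simp only: flip_exp_cmult times_divide_eq_right)
  qed
  ultimately have "(\<lambda>K. 1 / 2 * ((c * t) ^ m * flip_exp ((1 - exp (- 2 * (rate * t / real K))) / 2) K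
      (\<lambda>bs. (walk_max 1 bs / real K) ^ m))) \<longlonglongrightarrow> expectation (\<lambda>\<omega>. indicator ?A \<omega> * telegraph_max V0 N t \<omega> ^ m)"
    by (rule Lim_transform_eventually)
  moreover have "(\<lambda>K. 1 / 2 * ((c * t) ^ m * flip_exp ((1 - exp (- 2 * (rate * t / real K))) / 2) K
      (\<lambda>bs. (walk_max 1 bs / real K) ^ m))) \<longlonglongrightarrow>
      1 / 2 * ((c * t) ^ m * poisson_mean (rate * t) (\<lambda>n. beta_moment n (real m / 2)))"
    by (intro tendsto_intros walk_max_moment_limit) (use t m rate_pos in auto)
  ultimately have "expectation (\<lambda>\<omega>. indicator ?A \<omega> * telegraph_max V0 N t \<omega> ^ m) =
      1 / 2 * ((c * t) ^ m * poisson_mean (rate * t) (\<lambda>n. beta_moment n (real m / 2)))"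
    by (rule LIMSEQ_unique)
  then show ?thesis
    by (subst cond_expectation_initial_velocity) auto
qed

end

theorem mainTheorem16:
  fixes M :: "'a measure" and V0 :: "'a \<Rightarrow> real" and N :: "real \<Rightarrow> 'a \<Rightarrow> nat"
    and c rate t :: real
  assumes "symmetric_telegraph M V0 N c rate"
    and "t > 0"
  shows "(\<forall>m::nat. m \<ge> 1 \<longrightarrow>
           cond_expectation M (\<lambda>\<omega>. telegraph_max V0 N t \<omega> ^ m) {\<omega> \<in> space M. V0 \<omega> = c} =
             exp (- rate * t) * (c * t) ^ m * (2 / (rate * t)) powr ((real m - 1) / 2)
               * Gamma ((real m + 1) / 2)
               * (bessel_I ((real m - 1) / 2) (rate * t) + bessel_I ((real m + 1) / 2) (rate * t)))
         \<and> cond_expectation M (\<lambda>\<omega>. telegraph_max V0 N t \<omega>) {\<omega> \<in> space M. V0 \<omega> = c} =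
             exp (- rate * t) * (c * t) * (bessel_I 0 (rate * t) + bessel_I 1 (rate * t))"
proof -
  interpret symmetric_telegraph M V0 N c rate by fact
  have x: "rate * t > 0" using rate_pos assms(2) by simp
  have moments: "cond_expectation M (\<lambda>\<omega>. telegraph_max V0 N t \<omega> ^ m) {\<omega> \<in> space M. V0 \<omega> = c} =
             exp (- rate * t) * (c * t) ^ m * (2 / (rate * t)) powr ((real m - 1) / 2)
               * Gamma ((real m + 1) / 2)
               * (bessel_I ((real m - 1) / 2) (rate * t) + bessel_I ((real m + 1) / 2) (rate * t))"
    if "m \<ge> 1" for m
    using telegraph_max_moment[OF assms(2) that] poisson_mean_bessel[OF x that] by (simp add: mult_ac)
  moreover have "cond_expectation M (\<lambda>\<omega>. telegraph_max V0 N t \<omega>) {\<omega> \<in> space M. V0 \<omega> = c} =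
             exp (- rate * t) * (c * t) * (bessel_I 0 (rate * t) + bessel_I 1 (rate * t))"
    \<comment> \<open>For \<open>m = 1\<close> the prefactor is a positive base to the exponent 0,
      and \<open>Gamma 1 = 1\<close>.\<close>
    using moments[of 1] rate_pos assms(2) by simp
  ultimately show ?thesis by blast
qed

end
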